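(* Let $A$ be a Nakayama algebra over a field $k$ with a grading $\mathbf{d}$. Let $c$ be the number of connected components of the resolution quiver $R_A$, let $w$ be the weight of $R_A$, and let $d=\sum_a\mathbf{d}(x_a)$ be the sum of the degrees of all the arrows. Then the determinant of the graded Cartan matrix $C^{\mathbf{d}}_A(t)$ is $$\det C^{\mathbf{d}}_A(t)=\frac{(1-t^{dw})^{c}}{1-t^{d}}.$$
   Context: Fix a field $k$; all modules are finite dimensional right modules. Let $\Delta_n$ ($n\ge 1$) be the cyclic quiver with vertices $1,\dots,n$ and arrows $x_a\colon a\to a+1$ for $1\le a\le n-1$ and $x_n\colon n\to 1$. A Nakayama algebra of order $n$ is a finite dimensional algebra $A$ isomorphic to the quotient of the path algebra $k\Delta_n$ by an ideal generated by a finite set of nontrivial paths (arrows are allowed in this set). For a vertex $a$, let $e_a$ be the idempotent and $P_a=e_aA$ the indecomposable projective module at $a$; paths are composed so that $e_aA$ is spanned by the paths starting at $a$. Put $p_a=\dim_k P_a$. Let $\tau(a)=a+1$ for $1\le a\le n-1$ and $\tau(n)=1$. The resolution quiver $R_A$ has vertices $1,\dots,n$ and a unique arrow $a\to\gamma(a)$ for each $a$, where $\gamma(a)=\tau^{p_a}(a)$. The weight of a cycle $I$ is $w=\frac1n\sum_{a\in I}p_a$; it is a positive integer independent of the cycle chosen and is called the weight of $R_A$. A grading $\mathbf{d}$ on $A$ is a map from the set of arrows $\{x_1,\dots,x_n\}$ to $\mathbb{Z}$; the degree of a path is the sum of the degrees of its arrows, and $A_\ell$ denotes the degree $\ell$ part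 of $A$. The graded Cartan matrix $C^{\mathbf{d}}_A(t)=(c_{ab}(t))$ over $\mathbb{Z}[t^{\pm1}]$ has entries $c_{ab}(t)=\sum_\ell\dim_k(e_bA_\ell e_a)t^\ell$. When $d=0$ the displayed quotient is read as the value at $s=t^d=1$ of the polynomial $(1-s^{w})^{c}/(1-s)=(1+s+\cdots+s^{w-1})(1-s^{w})^{c-1}$. *)

theory Defs
  imports
    "HOL-Library.Poly_Mapping"
    "HOL-Algebra.Ideal"
    "HOL-Computational_Algebra.Polynomial_Factorial"
    "Jordan_Normal_Form.Determinant"
    "Graph_Theory.Graph_Theory"
begin

section \<open>Path algebras\<close>

text \<open>
  A path is a pair of its start vertex and its list of arrows; the trivial path at \<open>u\<close> is
  \<open>(u, [])\<close>.  Paths are composed from left to right, so \<open>p\<close> times \<open>q\<close> is nonzero iff \<open>p\<close> ends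
  where \<open>q\<close> starts.
\<close>

definition paths :: "('v, 'e) pre_digraph \<Rightarrow> ('v \<times> 'e list) set" where
  "paths G = {(u, es). \<exists>v. pre_digraph.awalk G u es v}"

definition path_end :: "('v, 'e) pre_digraph \<Rightarrow> 'v \<times> 'e list \<Rightarrow> 'v" where
  "path_end G p = pre_digraph.awlast G (fst p) (snd p)"

abbreviation path_elem :: "'v \<times> 'e list \<Rightarrow> ('v \<times> 'e list) \<Rightarrow>\<^sub>0 'k::field" where
  "path_elem p \<equiv> Poly_Mapping.single p 1"

definition path_mult ::
  "('v, 'e) pre_digraph \<Rightarrow> (('v \<times> 'e list) \<Rightarrow>\<^sub>0 'k::field) \<Rightarrow> (('v \<times> 'e list) \<Rightarrow>\<^sub>0 'k)
    \<Rightarrow> (('v \<times> 'e list) \<Rightarrow>\<^sub>0 'k)" where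
  "path_mult G f g =
    (\<Sum>p\<in>Poly_Mapping.keys f. \<Sum>q\<in>Poly_Mapping.keys g.
      if path_end G p = fst q
      then Poly_Mapping.single (fst p, snd p @ snd q) (Poly_Mapping.lookup f p * Poly_Mapping.lookup g q)
      else 0)"

definition path_algebra :: "('v, 'e) pre_digraph \<Rightarrow> (('v \<times> 'e list) \<Rightarrow>\<^sub>0 'k::field) ring" where
  "path_algebra G =
    \<lparr>carrier = {f. Poly_Mapping.keys f \<subseteq> paths G},
     monoid.mult = path_mult G,
     one = (\<Sum>u\<in>verts G. path_elem (u, [])),
     zero = 0,
     add = (+)\<rparr>"


section \<open>Nakayama algebras\<close>

definition tau :: "nat \<Rightarrow> nat \<Rightarrow> nat" where
  "tau n a = (if a = n then 1 else a + 1)"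

text \<open>The cyclic quiver; the arrow \<open>x\<^sub>a\<close> is encoded by its start vertex \<open>a\<close>.\<close>

definition cyclic_quiver :: "nat \<Rightarrow> (nat, nat) pre_digraph" where
  "cyclic_quiver n = \<lparr>verts = {1..n}, arcs = {1..n}, tail = (\<lambda>a. a), head = tau n\<rparr>"

text \<open>
  The algebra is the whole type \<open>'a\<close>.  Its isomorphism with the quotient of the path algebra by
  the ideal generated by \<open>rels\<close> is given as a surjective algebra homomorphism \<open>\<phi>\<close> with that
  ideal as kernel; only the values of \<open>\<phi>\<close> on the carrier of the path algebra matter.
\<close>

locale nakayama_algebra = vector_space scale
  for scale :: "'k::field \<Rightarrow> 'a::ring_1 \<Rightarrow> 'a" +
  fixes n :: nat
    and rels :: "(nat \<times> nat list) set"
    and \<phi> :: "((nat \<times> nat list) \<Rightarrow>\<^sub>0 'k) \<Rightarrow> 'a"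
  assumes scale_mult_left: "scale c x * y = scale c (x * y)"
    and scale_mult_right: "x * scale c y = scale c (x * y)"
    and finite_dimensional: "\<exists>B. finite B \<and> span B = UNIV"
    and order_pos: "n \<ge> 1"
    and rels_finite: "finite rels"
    and rels_paths: "rels \<subseteq> paths (cyclic_quiver n)"
    and rels_nontrivial: "(u, es) \<in> rels \<Longrightarrow> es \<noteq> []"
    and phi_add: "\<lbrakk>f \<in> carrier (path_algebra (cyclic_quiver n)); g \<in> carrier (path_algebra (cyclic_quiver n))\<rbrakk>
      \<Longrightarrow> \<phi> (f + g) = \<phi> f + \<phi> g"
    and phi_scale: "f \<in> carrier (path_algebra (cyclic_quiver n))
      \<Longrightarrow> \<phi> (Poly_Mapping.map (\<lambda>y. c * y) f) = scale c (\<phi> f)"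
    and phi_mult: "\<lbrakk>f \<in> carrier (path_algebra (cyclic_quiver n)); g \<in> carrier (path_algebra (cyclic_quiver n))\<rbrakk>
      \<Longrightarrow> \<phi> (f \<otimes>\<^bsub>path_algebra (cyclic_quiver n)\<^esub> g) = \<phi> f * \<phi> g"
    and phi_one: "\<phi> \<one>\<^bsub>path_algebra (cyclic_quiver n)\<^esub> = 1"
    and phi_surj: "\<phi> ` carrier (path_algebra (cyclic_quiver n)) = UNIV"
    and phi_kernel: "{f \<in> carrier (path_algebra (cyclic_quiver n)). \<phi> f = 0}
      = Idl\<^bsub>path_algebra (cyclic_quiver n)\<^esub> (path_elem ` rels)"
begin

definition idem :: "nat \<Rightarrow> 'a" where
  "idem a = \<phi> (path_elem (a, []))"

definition proj :: "nat \<Rightarrow> 'a set" where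
  "proj a = {idem a * x | x. True}"

definition proj_dim :: "nat \<Rightarrow> nat" where
  "proj_dim a = dim (proj a)"

definition gamma :: "nat \<Rightarrow> nat" where
  "gamma a = (tau n ^^ proj_dim a) a"

text \<open>As above, an arrow of the resolution quiver is encoded by its start vertex.\<close>

definition resolution_quiver :: "(nat, nat) pre_digraph" where
  "resolution_quiver = \<lparr>verts = {1..n}, arcs = {1..n}, tail = (\<lambda>a. a), head = gamma\<rparr>"

text \<open>A cycle is given by its list of arrows; loops are cycles.\<close>

definition cycle_weight :: "nat list \<Rightarrow> rat" where
  "cycle_weight es = (1 / of_nat n) * (\<Sum>a\<in>tail resolution_quiver ` set es. of_nat (proj_dim a))"

definition weight :: nat where
  "weight = (THE w. \<forall>es. pre_digraph.cycle resolution_quiver es \<longrightarrow> cycle_weight es = of_nat w)"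

text \<open>Connected components of the quiver are those of its underlying undirected graph.\<close>

definition num_components :: nat where
  "num_components = card (pre_digraph.sccs (with_proj (mk_symmetric resolution_quiver)))"

definition path_degree :: "(nat \<Rightarrow> int) \<Rightarrow> nat \<times> nat list \<Rightarrow> int" where
  "path_degree \<d> p = (\<Sum>a\<leftarrow>snd p. \<d> a)"

definition degree_part :: "(nat \<Rightarrow> int) \<Rightarrow> int \<Rightarrow> 'a set" where
  "degree_part \<d> l = span {\<phi> (path_elem p) | p. p \<in> paths (cyclic_quiver n) \<and> path_degree \<d> p = l}"

definition cartan_dim :: "(nat \<Rightarrow> int) \<Rightarrow> nat \<Rightarrow> nat \<Rightarrow> int \<Rightarrow> nat" where
  "cartan_dim \<d> a b l = dim {idem b * x * idem a | x. x \<in> degree_part \<d> l}"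

text \<open>
  Laurent polynomials over the integers are the group ring of the additive group of integers,
  that is \<open>int \<Rightarrow>\<^sub>0 int\<close>; the monomial \<open>t\<^sup>l\<close> is \<open>Poly_Mapping.single l 1\<close>.
  Matrix indices start at 0, vertices at 1.
\<close>

definition graded_cartan :: "(nat \<Rightarrow> int) \<Rightarrow> (int \<Rightarrow>\<^sub>0 int) mat" where
  "graded_cartan \<d> = Matrix.mat n n (\<lambda>(i, j).
    \<Sum>l | cartan_dim \<d> (i + 1) (j + 1) l \<noteq> 0.
      Poly_Mapping.single l (int (cartan_dim \<d> (i + 1) (j + 1) l)))"

end

abbreviation tpow :: "int \<Rightarrow> (int \<Rightarrow>\<^sub>0 int)" where
  "tpow l \<equiv> Poly_Mapping.single l 1"

end

(*
  Identify the columns of the Cartan matrix with intervals on the universal cover of the cyclic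
  quiver: up to conjugation by a diagonal matrix, column b is v_b + v_(b+1) + ... + v_(b+p_b-1), where
  v_(y+n) = s v_y and s = t^d.  Multiplying by 1 - N, where N is the shift v_y -> v_(y+1), telescopes
  column b to v_b - v_(b+p_b), that is, gives 1 - F with F the monomial matrix of the resolution quiver.
  Since det(1 - N) = 1 - s, and det(1 - F) is the product of 1 - s^w over the cycles, one for each
  component, the formula follows once all cycles have the same weight.  This is because p_a <= p_(a+1) + 1
  makes y -> y + p_y monotone, so that it has a rotation number and all its cycles have equal
  length and weight.  The computation takes place over the polynomial ring in s, where 1 - s can be
  cancelled, and s is specialised to t^d afterwards; this covers d = 0.
*)
theory Submission
  imports Defs
begin

section \<open>Determinants of monomial matrices\<close>

text \<open>The algebra is known only through \<open>\<phi>\<close>, so the intervals have to be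
  earned: as the relations are paths, the paths with nonzero image form a basis, and factors of a
  nonzero path are nonzero. Prefixes show that a column is an unbroken interval; suffixes give the
  inequality between neighbouring dimensions. The diagonal conjugation exists because on the
  universal cover the degree of a walk is a difference of values of a potential that grows by d with
  each turn, so that only the number of turns survives. The cycles keep 1 - F from being triangular.
  Replacing one basis vector per cycle by the sum over the cycle cures this: its column collapses to
  a multiple of one basis vector, and every other column leads one step closer to a chosen
  vertex.\<close>

lemma det_triangular_wrt_rank:
  fixes A :: "'a::comm_ring_1 mat" and rank :: "nat \<Rightarrow> nat"
  assumes A: "A \<in> carrier_mat n n"
    and rank: "\<And>i j. \<lbrakk>i < n; j < n; i \<noteq> j; A $$ (i, j) \<noteq> 0\<rbrakk> \<Longrightarrow> rank i < rank j"
  shows "det A = (\<Prod>i<n. A $$ (i, i))"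
proof -
  let ?P = "{p. p permutes {0..<n}}"
  let ?g = "\<lambda>p. signof p * (\<Prod>i = 0..<n. A $$ (i, p i))"
  have zero: "?g p = 0" if p: "p permutes {0..<n}" and ne: "p \<noteq> id" for p
  proof -
    have "\<exists>i\<in>{0..<n}. A $$ (i, p i) = 0"
    proof (rule ccontr)
      assume "\<not> ?thesis"
      then have nz: "A $$ (i, p i) \<noteq> 0" if "i < n" for i using that by auto
      \<comment> \<open>a permutation preserves the total rank, so it cannot raise ranks\<close>
      have lt: "p i < n" if "i < n" for i using permutes_in_image[OF p, of i] that by auto
      have le: "rank i \<le> rank (p i)" if "i < n" for i
        using rank[OF that lt[OF that]] nz[OF that] by (cases "p i = i") auto
      obtain i where i: "p i \<noteq> i" using ne by (auto simp: fun_eq_iff)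
      then have "i < n" using p by (meson atLeastLessThan_iff permutes_def zero_le)
      then have "rank i < rank (p i)" using rank[OF _ lt] nz i by metis
      then have "(\<Sum>i\<in>{0..<n}. rank i) < (\<Sum>i\<in>{0..<n}. rank (p i))"
        using le \<open>i < n\<close> by (intro sum_strict_mono_ex1) auto
      moreover have "(\<Sum>i\<in>{0..<n}. rank (p i)) = (\<Sum>i\<in>{0..<n}. rank i)"
        using sum.permute[OF p, of rank] by (simp add: o_def)
      ultimately show False by simp
    qed
    then have "(\<Prod>i = 0..<n. A $$ (i, p i)) = 0" by (intro prod_zero) auto
    then show ?thesis by simp
  qed
  have "det A = ?g id + (\<Sum>p\<in>?P - {id}. ?g p)"
    unfolding det_def'[OF A]
    by (rule sum.remove) (auto simp: finite_permutations permutes_id)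
  also have "(\<Sum>p\<in>?P - {id}. ?g p) = 0"
    by (rule sum.neutral) (use zero in auto)
  finally show ?thesis by (simp add: lessThan_atLeast0)
qed

section \<open>Maps of the cover that commute with translation by \<open>n\<close>, and their
  rotation\<close>

lemma funpow_add_period:
  fixes f :: "nat \<Rightarrow> nat"
  assumes "\<And>y. f (y + n) = f y + n"
  shows "(f ^^ k) (y + n * q) = (f ^^ k) y + n * q"
proof -
  have f1: "f (y + n * q) = f y + n * q" for y
    by (induction q) (use assms in \<open>auto simp: algebra_simps\<close>, metis add.assoc add.commute assms)
  show ?thesis by (induction k) (auto simp: f1)
qed

lemma funpow_mod_period:
  fixes f :: "nat \<Rightarrow> nat"
  assumes "\<And>y. f (y + n) = f y + n"
  shows "(f ^^ k) (y mod n) mod n = (f ^^ k) y mod n"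
  using funpow_add_period[where f = f, OF assms, of k "y mod n" "y div n"] by simp

lemma common_rotation:
  fixes f :: "nat \<Rightarrow> nat"
  assumes period: "\<And>y. f (y + n) = f y + n" and "mono f"
    and r: "r < n" "(f ^^ l) r = r + n * w"
    and r': "r' < n" "(f ^^ l') r' = r' + n * w'" "l' > 0"
  shows "(f ^^ l) r' = r' + n * w"
    \<comment> \<open>\<open>f ^^ l\<close> minus \<open>n * w\<close> is monotone with the fixed point \<open>r\<close>. Were \<open>r'\<close> moved by it, the iterates of
      \<open>r'\<close> would drift monotonically and, by periodicity, without bound, past a translate of \<open>r\<close>.\<close>
proof -
  define g where "g = f ^^ l"
  have g_mono: "(g ^^ k) x \<le> (g ^^ k) y" if "x \<le> y" for k x y
    using that \<open>mono f\<close> by (metis g_def funpow_mono mono_def)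
  have g_period: "(g ^^ k) (y + n * q) = (g ^^ k) y + n * q" for k y q
    using funpow_add_period[where f = f, OF period] by (simp add: g_def funpow_mult)
  have gr: "(g ^^ k) r = r + n * (w * k)" for k
  proof (induction k)
    case (Suc k)
    then have "(g ^^ Suc k) r = g (r + n * (w * k))" by simp
    also have "\<dots> = g r + n * (w * k)" using g_period[of 1 r] by simp
    finally show ?case using r by (simp add: g_def algebra_simps)
  qed simp
  have f': "(f ^^ (l' * k)) r' = r' + n * (w' * k)" for k
  proof (induction k)
    case (Suc k)
    have "(f ^^ (l' * Suc k)) r' = (f ^^ l') ((f ^^ (l' * k)) r')" by (simp add: funpow_add)
    also have "\<dots> = (f ^^ l') r' + n * (w' * k)"
      using Suc funpow_add_period[where f = f, OF period] by simp
    finally show ?case using r' by (simp add: algebra_simps)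
  qed simp
  have gr': "(g ^^ (l' * k)) r' = r' + n * (w' * l * k)" for k
    using f'[of "l * k"] by (simp add: g_def funpow_mult ac_simps)
  \<comment> \<open>\<open>r\<close> and \<open>r'\<close> lie in the same period, so monotonicity
    keeps their \<open>g\<close>-orbits at most \<open>n\<close> apart, while the orbit of
    \<open>r\<close> advances by exactly \<open>n * w\<close> per step.\<close>
  have up: "(g ^^ k) r' \<le> r + n + n * (w * k)" for k
    using g_mono[of r' "r + n * 1" k] g_period[of k r 1] gr[of k] r' by simp
  have down: "r + n * (w * k) \<le> (g ^^ k) r' + n" for k
    using g_mono[of r "r' + n * 1" k] g_period[of k r' 1] gr[of k] r by simp
  have "\<not> g r' > r' + n * w"
  proof
    assume gt: "g r' > r' + n * w"
    have "(g ^^ Suc k) r' > r' + n * (w * Suc k)" for k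
    proof (induction k)
      case (Suc k)
      have "r' + n * (w * Suc (Suc k)) = r' + n * w + n * (w * Suc k)" by (simp add: algebra_simps)
      also have "\<dots> < g r' + n * (w * Suc k)" using gt by simp
      also have "\<dots> = g (r' + n * (w * Suc k))" using g_period[of 1 r'] by simp
      also have "\<dots> \<le> g ((g ^^ Suc k) r')" using g_mono[of _ _ 1] Suc by simp
      finally show ?case by simp
    qed (use gt in simp)
    \<comment> \<open>After \<open>l'\<close> steps the position of \<open>r'\<close> is known
      exactly, and a strict inequality between multiples of \<open>n\<close> leaves an excess of at
      least \<open>n\<close>. That alone may still respect \<open>up\<close>; after
      \<open>2 * l'\<close> steps the excess is \<open>2 * n\<close>, which does not, because
      \<open>r < n\<close>.\<close>
    from this[of "l' - 1"] have "n * (w * l') < n * (w' * l)"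
      using gr'[of 1] r' by simp
    then have "w' * l \<ge> w * l' + 1" by simp
    then have "n * (w' * l * 2) \<ge> n * ((w * l' + 1) * 2)"
      by (intro mult_le_mono2 mult_le_mono1)
    then show False using up[of "l' * 2"] gr'[of 2] r by (simp add: algebra_simps)
  qed
  moreover have "\<not> g r' < r' + n * w"
  proof
    assume lt: "g r' < r' + n * w"
    have "(g ^^ Suc k) r' < r' + n * (w * Suc k)" for k
    proof (induction k)
      case (Suc k)
      have "g ((g ^^ Suc k) r') \<le> g (r' + n * (w * Suc k))" using g_mono[of _ _ 1] Suc by simp
      also have "\<dots> = g r' + n * (w * Suc k)" using g_period[of 1 r'] by simp
      also have "\<dots> < r' + n * w + n * (w * Suc k)" using lt by simp
      also have "\<dots> = r' + n * (w * Suc (Suc k))" by (simp add: algebra_simps)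
      finally show ?case by simp
    qed (use lt in simp)
    from this[of "l' - 1"] have "n * (w' * l) < n * (w * l')"
      using gr'[of 1] r' by simp
    then have "w * l' \<ge> w' * l + 1" by simp
    then have "n * (w * l' * 2) \<ge> n * ((w' * l + 1) * 2)"
      by (intro mult_le_mono2 mult_le_mono1)
    then show False using down[of "l' * 2"] gr'[of 2] r' by (simp add: algebra_simps)
  qed
  ultimately show ?thesis by (simp add: g_def)
qed

section \<open>Linear maps induced by maps of the cover, and their determinants\<close>

text \<open>
  Vertices are \<open>0, \<dots>, n - 1\<close> here. The \<open>i\<close>-th coordinate of the vector attached to a point \<open>y\<close> of the universal
  cover, where translation by \<open>n\<close> acts as multiplication by the polynomial variable.
\<close>

definition cover_vec :: "nat \<Rightarrow> nat \<Rightarrow> nat \<Rightarrow> int poly" where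
  "cover_vec n i y = (if y mod n = i then monom 1 (y div n) else 0)"

lemma cover_vec_less: "y < n \<Longrightarrow> cover_vec n i y = (if y = i then 1 else 0)"
  by (simp add: cover_vec_def)

lemma cover_vec_add: "n > 0 \<Longrightarrow> cover_vec n i (y + n * q) = monom 1 q * cover_vec n i y"
  by (simp add: cover_vec_def mult_monom add.commute)

text \<open>This is a matrix-vector product: commuting with translation is what makes v_y -> v_(f y)
  linear over the polynomials, so its values on the basis determine it on all of the cover.\<close>

lemma sum_cover_vec:
  assumes "n > 0" and period: "\<And>y. f (y + n) = f y + n"
  shows "(\<Sum>k<n. cover_vec n i (f k) * cover_vec n k y) = cover_vec n i (f y)"
proof -
  have "(\<Sum>k<n. cover_vec n i (f k) * cover_vec n k y)
      = (\<Sum>k<n. if k = y mod n then cover_vec n i (f k) * monom 1 (y div n) else 0)"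
    by (intro sum.cong) (auto simp: cover_vec_def)
  also have "\<dots> = cover_vec n i (f (y mod n)) * monom 1 (y div n)"
    using \<open>n > 0\<close> by simp
  also have "\<dots> = cover_vec n i (f (y mod n) + n * (y div n))"
    by (simp add: cover_vec_add[OF \<open>n > 0\<close>] mult.commute)
  also have "f (y mod n) + n * (y div n) = f y"
    using funpow_add_period[where f = f, OF period, of 1 "y mod n" "y div n"] by simp
  finally show ?thesis .
qed

text \<open>The identity minus the linear map induced by \<open>f\<close>. One definition serves
  both 1 - N, with \<open>f = Suc\<close>, and 1 - F.\<close>

definition shift_mat :: "nat \<Rightarrow> (nat \<Rightarrow> nat) \<Rightarrow> int poly mat" where
  "shift_mat n f = Matrix.mat n n (\<lambda>(i, j). cover_vec n i j - cover_vec n i (f j))"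

lemma shift_mat_carrier [simp]: "shift_mat n f \<in> carrier_mat n n"
  by (simp add: shift_mat_def)

text \<open>Columns that are sums of cover vectors are treated term by term, so the product
  telescopes as soon as the points \<open>h j m\<close> are successive iterates of \<open>f\<close>.
  This happens for the cycle sums and for the Cartan columns.\<close>

lemma shift_mat_mult_index:
  assumes "n > 0" and period: "\<And>y. f (y + n) = f y + n" and "i < n" "j < n"
  shows "(shift_mat n f * Matrix.mat n n (\<lambda>(i, j). \<Sum>m<l j. cover_vec n i (h j m))) $$ (i, j)
    = (\<Sum>m<l j. cover_vec n i (h j m) - cover_vec n i (f (h j m)))"
proof -
  have one: "(\<Sum>k<n. (cover_vec n i k - cover_vec n i (f k)) * cover_vec n k y)
      = cover_vec n i y - cover_vec n i (f y)" for y
    using sum_cover_vec[OF \<open>n > 0\<close>, of "\<lambda>x. x" i y] sum_cover_vec[where f = f, OF \<open>n > 0\<close> period, of i y]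
    by (simp add: left_diff_distrib sum_subtractf)
  have "(shift_mat n f * Matrix.mat n n (\<lambda>(i, j). \<Sum>m<l j. cover_vec n i (h j m))) $$ (i, j)
     = (\<Sum>k<n. (cover_vec n i k - cover_vec n i (f k)) * (\<Sum>m<l j. cover_vec n k (h j m)))"
    using assms by (simp add: shift_mat_def scalar_prod_def lessThan_atLeast0)
  also have "\<dots> = (\<Sum>m<l j. \<Sum>k<n. (cover_vec n i k - cover_vec n i (f k)) * cover_vec n k (h j m))"
    unfolding sum_distrib_left by (rule sum.swap)
  finally show ?thesis by (simp add: one)
qed

text \<open>The hypotheses on \<open>S\<close> say that it meets every cycle of the induced map on
  residues in exactly one point: \<open>notin\<close> forbids an early return, and
  \<open>reach\<close> leaves out no cycle. Each cycle then contributes one factor, with its winding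
  number as exponent.\<close>

lemma det_shift_mat:
  assumes "n > 0" and period: "\<And>y. f (y + n) = f y + n"
    and "S \<subseteq> {..<n}"
    and l: "\<And>r. r \<in> S \<Longrightarrow> l r > 0 \<and> (f ^^ l r) r = r + n * w r"
    and notin: "\<And>r j. \<lbrakk>r \<in> S; 0 < j; j < l r\<rbrakk> \<Longrightarrow> (f ^^ j) r mod n \<notin> S"
    and reach: "\<And>i. i < n \<Longrightarrow> \<exists>k. (f ^^ k) i mod n \<in> S"
  shows "det (shift_mat n f) = (\<Prod>r\<in>S. 1 - monom 1 (w r))"
proof -
  \<comment> \<open>\<open>U\<close> replaces the basis vector of each \<open>j \<in> S\<close> by the sum over its cycle, so that the product with
    \<open>shift_mat n f\<close> telescopes in these columns.\<close>
  define l' where "l' j = (if j \<in> S then l j else 1)" for j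
  define U where "U = Matrix.mat n n (\<lambda>(i, j). \<Sum>m<l' j. cover_vec n i ((f ^^ m) j))"
  have U: "U \<in> carrier_mat n n" by (simp add: U_def)
  have "det U = (\<Prod>i<n. U $$ (i, i))"
  \<comment> \<open>Two ranks suffice: an off-diagonal entry can only occur in the column of a
    representative, at a row that its cycle visits before returning, which is outside
    \<open>S\<close>.\<close>
  proof (rule det_triangular_wrt_rank[OF U, where rank = "\<lambda>i. if i \<in> S then 1 else 0"])
    fix i j assume ij: "i < n" "j < n" "i \<noteq> j" "U $$ (i, j) \<noteq> 0"
    then have "(\<Sum>m<l' j. cover_vec n i ((f ^^ m) j)) \<noteq> 0" by (simp add: U_def)
    then obtain m where m: "m < l' j" "cover_vec n i ((f ^^ m) j) \<noteq> 0"
      by (auto elim: sum.not_neutral_contains_not_neutral)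
    then have i: "i = (f ^^ m) j mod n" by (auto simp: cover_vec_def split: if_splits)
    with ij have "m \<noteq> 0" by (cases m) auto
    with m have "j \<in> S" "m < l j" by (auto simp: l'_def split: if_splits)
    with notin[of j m] i \<open>m \<noteq> 0\<close>
    show "(if i \<in> S then 1 else 0 :: nat) < (if j \<in> S then 1 else 0)" by auto
  qed
  also have "\<dots> = 1"
  proof (rule prod.neutral, clarify)
    fix i assume i: "i < n"
    have "cover_vec n i ((f ^^ m) i) = 0" if "0 < m" "m < l' i" for m
      using notin[of i m] that by (auto simp: l'_def cover_vec_def split: if_splits)
    then have "(\<Sum>m<l' i. cover_vec n i ((f ^^ m) i)) = (\<Sum>m<l' i. if m = 0 then 1 else 0)"
      using i by (intro sum.cong) (auto simp: cover_vec_less)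
    then show "U $$ (i, i) = 1" using i l[of i] by (auto simp: U_def l'_def)
  qed
  finally have det_U: "det U = 1" .

  define T where "T = shift_mat n f * U"
  have T: "T \<in> carrier_mat n n" using mult_carrier_mat[OF shift_mat_carrier U] by (simp add: T_def)
  have T_index: "T $$ (i, j) = cover_vec n i j - cover_vec n i ((f ^^ l' j) j)" if "i < n" "j < n" for i j
  proof -
    have "T $$ (i, j) = (\<Sum>m<l' j. cover_vec n i ((f ^^ m) j) - cover_vec n i ((f ^^ Suc m) j))"
      unfolding T_def U_def using shift_mat_mult_index[where f = f, OF \<open>n > 0\<close> period that,
        where l = l' and h = "\<lambda>j m. (f ^^ m) j"]
      by simp
    then show ?thesis
      using sum_lessThan_telescope'[of "\<lambda>m. cover_vec n i ((f ^^ m) j)" "l' j"] by simp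
  qed
  have T_S: "T $$ (i, j) = (if i = j then 1 - monom 1 (w j) else 0)" if "i < n" "j < n" "j \<in> S" for i j
    using T_index[OF that(1,2)] that l[of j] cover_vec_add[OF \<open>n > 0\<close>, of i j "w j"]
    by (auto simp: l'_def cover_vec_less)
  \<comment> \<open>The number of steps needed to enter \<open>S\<close>. A column outside
    \<open>S\<close> involves only \<open>j\<close> and its successor, which is one step
    closer.\<close>
  define rank where "rank i = (LEAST k. (f ^^ k) i mod n \<in> S)" for i
  have rank: "rank (f j mod n) < rank j" if j: "j < n" "j \<notin> S" for j
  proof -
    have r: "(f ^^ rank j) j mod n \<in> S" unfolding rank_def using reach[OF j(1)] by (rule LeastI_ex)
    with j obtain m where m: "rank j = Suc m" by (cases "rank j") auto
    with r have "(f ^^ m) (f j mod n) mod n \<in> S"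
      by (simp add: funpow_mod_period[where f = f, OF period] funpow_swap1)
    then have "rank (f j mod n) \<le> m" unfolding rank_def by (rule Least_le)
    with m show ?thesis by simp
  qed
  have "det T = (\<Prod>i<n. T $$ (i, i))"
  proof (rule det_triangular_wrt_rank[OF T, where rank = rank])
    fix i j assume ij: "i < n" "j < n" "i \<noteq> j" "T $$ (i, j) \<noteq> 0"
    with T_S have "j \<notin> S" by metis
    with ij T_index[of i j] have "i = f j mod n"
      by (auto simp: l'_def cover_vec_def split: if_splits)
    with rank \<open>j < n\<close> \<open>j \<notin> S\<close> show "rank i < rank j" by auto
  qed
  also have "\<dots> = (\<Prod>i<n. if i \<in> S then 1 - monom 1 (w i) else 1)"
  proof (intro prod.cong refl)
    fix i assume "i \<in> {..<n}"
    then have i: "i < n" by simp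
    show "T $$ (i, i) = (if i \<in> S then 1 - monom 1 (w i) else 1)"
    proof (cases "i \<in> S")
      case False
      \<comment> \<open>A fixed residue outside \<open>S\<close> could never enter \<open>S\<close>,
        so nothing is subtracted from the diagonal entry 1.\<close>
      with rank[OF i] have "f i mod n \<noteq> i" by auto
      with False i show ?thesis by (auto simp: T_index l'_def cover_vec_def)
    qed (use T_S i in auto)
  qed
  also have "\<dots> = (\<Prod>r\<in>S. 1 - monom 1 (w r))"
    using \<open>S \<subseteq> {..<n}\<close> by (subst prod.inter_restrict[symmetric]) (auto simp: Int_absorb1)
  finally show ?thesis
    using det_mult[OF shift_mat_carrier U, of f] det_U by (simp add: T_def)
qed

lemma det_interval_mat:
  fixes p :: "nat \<Rightarrow> nat"
  assumes "n > 0" "S \<subseteq> {..<n}"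
    and f: "\<And>y. f y = y + p (y mod n)"
    and "\<And>r. r \<in> S \<Longrightarrow> l r > 0 \<and> (f ^^ l r) r = r + n * w r"
    and "\<And>r j. \<lbrakk>r \<in> S; 0 < j; j < l r\<rbrakk> \<Longrightarrow> (f ^^ j) r mod n \<notin> S"
    and "\<And>i. i < n \<Longrightarrow> \<exists>k. (f ^^ k) i mod n \<in> S"
  shows "(1 - monom 1 1) * det (Matrix.mat n n (\<lambda>(i, j). \<Sum>m<p j. cover_vec n i (j + m)))
    = (\<Prod>r\<in>S. 1 - monom 1 (w r))"
proof -
  let ?C = "Matrix.mat n n (\<lambda>(i, j). \<Sum>m<p j. cover_vec n i (j + m))"
  have Suc_pow: "(Suc ^^ k) y = y + k" for k y by (induction k) auto
  \<comment> \<open>The shift is a single cycle: \<open>0\<close> returns after \<open>n\<close>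
    steps, having wound once, and \<open>i\<close> reaches it in \<open>n - i\<close> steps.\<close>
  have "det (shift_mat n Suc) = (\<Prod>r\<in>{0::nat}. 1 - monom 1 1)"
  proof (rule det_shift_mat[where l = "\<lambda>_. n" and w = "\<lambda>_. 1"])
    show "\<exists>k. (Suc ^^ k) i mod n \<in> {0}" if "i < n" for i
      using that by (auto simp: Suc_pow intro!: exI[of _ "n - i"])
  qed (use \<open>n > 0\<close> in \<open>auto simp: Suc_pow\<close>)
  moreover have "shift_mat n Suc * ?C = shift_mat n f"
  proof (rule eq_matI)
    fix i j assume "i < dim_row (shift_mat n f)" "j < dim_col (shift_mat n f)"
    then have ij: "i < n" "j < n" by (auto simp: shift_mat_def)
    have "(shift_mat n Suc * ?C) $$ (i, j)
        = (\<Sum>m<p j. cover_vec n i (j + m) - cover_vec n i (j + Suc m))"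
      using shift_mat_mult_index[where f = Suc, OF \<open>n > 0\<close> _ ij, where l = p and h = "\<lambda>j m. j + m"] by simp
    also have "\<dots> = cover_vec n i j - cover_vec n i (j + p j)"
      using sum_lessThan_telescope'[of "\<lambda>m. cover_vec n i (j + m)" "p j"] by simp
    finally show "(shift_mat n Suc * ?C) $$ (i, j) = shift_mat n f $$ (i, j)"
      using ij by (simp add: shift_mat_def f)
  qed (auto simp: shift_mat_def)
  moreover have "det (shift_mat n f) = (\<Prod>r\<in>S. 1 - monom 1 (w r))"
    using assms by (intro det_shift_mat[where l = l]) (auto simp: f)
  ultimately show ?thesis using det_mult[OF shift_mat_carrier, of ?C n Suc] by simp
qed

section \<open>Path algebras as rings\<close>

lemma poly_mapping_induct_keys [consumes 1, case_names zero single add]: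
  fixes f :: "'a \<Rightarrow>\<^sub>0 'b::comm_monoid_add"
  assumes "Poly_Mapping.keys f \<subseteq> A"
    and zero: "P 0"
    and single: "\<And>p c. p \<in> A \<Longrightarrow> P (Poly_Mapping.single p c)"
    and add: "\<And>f g. \<lbrakk>Poly_Mapping.keys f \<subseteq> A; Poly_Mapping.keys g \<subseteq> A; P f; P g\<rbrakk> \<Longrightarrow> P (f + g)"
  shows "P f"
proof -
  let ?s = "\<lambda>p. Poly_Mapping.single p (Poly_Mapping.lookup f p)"
  have "B \<subseteq> A \<Longrightarrow> Poly_Mapping.keys (sum ?s B) \<subseteq> A \<and> P (sum ?s B)" if "finite B" for B
    using that
  proof induction
    case (insert p B)
    then have *: "Poly_Mapping.keys (?s p) \<subseteq> A" "P (?s p)" by (auto intro: single)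
    with insert have "P (?s p + sum ?s B)" by (intro add) auto
    moreover have "Poly_Mapping.keys (?s p + sum ?s B) \<subseteq> A"
      using * insert Poly_Mapping.keys_add[of "?s p" "sum ?s B"] by blast
    ultimately show ?case using insert by simp
  qed (simp add: zero)
  moreover have "f = sum ?s (Poly_Mapping.keys f)"
    by (rule poly_mapping_eqI) (simp add: lookup_sum lookup_single when_def in_keys_iff)
  ultimately show ?thesis using assms(1) by (metis finite_keys)
qed

lemma keys_add_subset: "\<lbrakk>Poly_Mapping.keys f \<subseteq> A; Poly_Mapping.keys g \<subseteq> A\<rbrakk>
    \<Longrightarrow> Poly_Mapping.keys (f + g) \<subseteq> A"
  using Poly_Mapping.keys_add[of f g] by blast

text \<open>Supports change under addition, so the summands in a distributive law have to be written
  over a common index set.\<close>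

lemma path_mult_superset:
  assumes "finite P" "Poly_Mapping.keys f \<subseteq> P" "finite Q" "Poly_Mapping.keys g \<subseteq> Q"
  shows "path_mult G f g = (\<Sum>p\<in>P. \<Sum>q\<in>Q.
      if path_end G p = fst q
      then Poly_Mapping.single (fst p, snd p @ snd q) (Poly_Mapping.lookup f p * Poly_Mapping.lookup g q)
      else 0)"
  unfolding path_mult_def
proof (rule sum.mono_neutral_cong_left[OF assms(1,2)])
  show "\<forall>p\<in>P - Poly_Mapping.keys f. (\<Sum>q\<in>Q. if path_end G p = fst q
      then Poly_Mapping.single (fst p, snd p @ snd q) (Poly_Mapping.lookup f p * Poly_Mapping.lookup g q)
      else 0) = 0"
    by (auto simp: in_keys_iff intro!: sum.neutral)
  fix p
  show "(\<Sum>q\<in>Poly_Mapping.keys g. if path_end G p = fst q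
      then Poly_Mapping.single (fst p, snd p @ snd q) (Poly_Mapping.lookup f p * Poly_Mapping.lookup g q)
      else 0) = (\<Sum>q\<in>Q. if path_end G p = fst q
      then Poly_Mapping.single (fst p, snd p @ snd q) (Poly_Mapping.lookup f p * Poly_Mapping.lookup g q)
      else 0)"
    by (rule sum.mono_neutral_left[OF assms(3,4)]) (auto simp: in_keys_iff)
qed

lemma path_mult_add_left: "path_mult G (f + f') g = path_mult G f g + path_mult G f' g"
proof -
  let ?P = "Poly_Mapping.keys f \<union> Poly_Mapping.keys f'" and ?Q = "Poly_Mapping.keys g"
  have "Poly_Mapping.keys (f + f') \<subseteq> ?P" by (rule Poly_Mapping.keys_add)
  then show ?thesis
    by (subst (1 2 3) path_mult_superset[where P = ?P and Q = ?Q])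
      (auto simp: lookup_add distrib_right single_add simp flip: sum.distrib intro!: sum.cong)
qed

lemma path_mult_add_right: "path_mult G f (g + g') = path_mult G f g + path_mult G f g'"
proof -
  let ?P = "Poly_Mapping.keys f" and ?Q = "Poly_Mapping.keys g \<union> Poly_Mapping.keys g'"
  have "Poly_Mapping.keys (g + g') \<subseteq> ?Q" by (rule Poly_Mapping.keys_add)
  then show ?thesis
    by (subst (1 2 3) path_mult_superset[where P = ?P and Q = ?Q])
      (auto simp: lookup_add distrib_left single_add simp flip: sum.distrib intro!: sum.cong)
qed

lemma path_mult_zero [simp]: "path_mult G 0 g = 0" "path_mult G f 0 = 0"
  by (simp_all add: path_mult_def)

lemma path_mult_sum_left: "path_mult G (\<Sum>i\<in>I. h i) g = (\<Sum>i\<in>I. path_mult G (h i) g)"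
  by (induction I rule: infinite_finite_induct) (auto simp: path_mult_add_left)

lemma path_mult_sum_right: "path_mult G f (\<Sum>i\<in>I. h i) = (\<Sum>i\<in>I. path_mult G f (h i))"
  by (induction I rule: infinite_finite_induct) (auto simp: path_mult_add_right)

lemma path_mult_single:
  "path_mult G (Poly_Mapping.single p a) (Poly_Mapping.single q b)
    = (if path_end G p = fst q then Poly_Mapping.single (fst p, snd p @ snd q) (a * b) else 0)"
  by (subst path_mult_superset[where P = "{p}" and Q = "{q}"]) auto

lemma path_end_append:
  "path_end G (fst p, snd p @ es) = path_end G (path_end G p, es)"
  by (simp add: path_end_def pre_digraph.awalk_verts_conv)

lemma path_end_Nil [simp]: "path_end G (u, []) = u"
  by (simp add: path_end_def pre_digraph.awalk_verts.simps)

text \<open>Both sides are additive in each of the three factors; these are reduced to multiples of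
  single paths one at a time, the last factor first.\<close>

lemma path_mult_assoc: "path_mult G (path_mult G f g) h = path_mult G f (path_mult G g h)"
proof -
  have single: "path_mult G (path_mult G (Poly_Mapping.single p a) (Poly_Mapping.single q b)) (Poly_Mapping.single r c)
      = path_mult G (Poly_Mapping.single p a) (path_mult G (Poly_Mapping.single q b) (Poly_Mapping.single r c))"
    for p q r a b c
    by (cases q) (auto simp: path_mult_single path_end_append mult.assoc)
  have one: "path_mult G (path_mult G (Poly_Mapping.single p a) (Poly_Mapping.single q b)) h
      = path_mult G (Poly_Mapping.single p a) (path_mult G (Poly_Mapping.single q b) h)" for p q a b
    by (induction h rule: poly_mapping_induct_keys[where A = UNIV, OF subset_UNIV])
      (simp_all add: single path_mult_add_right)
  have two: "path_mult G (path_mult G (Poly_Mapping.single p a) g) h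
      = path_mult G (Poly_Mapping.single p a) (path_mult G g h)" for p a
    by (induction g rule: poly_mapping_induct_keys[where A = UNIV, OF subset_UNIV])
      (simp_all add: one path_mult_add_right path_mult_add_left)
  show ?thesis
    by (induction f rule: poly_mapping_induct_keys[where A = UNIV, OF subset_UNIV])
      (simp_all add: two path_mult_add_left)
qed

lemma keys_path_multE:
  assumes "x \<in> Poly_Mapping.keys (path_mult G f g)"
  obtains p q where "x = (fst p, snd p @ snd q)" "p \<in> Poly_Mapping.keys f" "q \<in> Poly_Mapping.keys g"
    "path_end G p = fst q"
proof -
  let ?t = "\<lambda>p q. if path_end G p = fst q
      then Poly_Mapping.single (fst p, snd p @ snd q) (Poly_Mapping.lookup f p * Poly_Mapping.lookup g q)
      else 0"
  obtain p where p: "p \<in> Poly_Mapping.keys f"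
      and "x \<in> Poly_Mapping.keys (\<Sum>q\<in>Poly_Mapping.keys g. ?t p q)"
    using assms keys_sum unfolding path_mult_def by fast
  then obtain q where "q \<in> Poly_Mapping.keys g" "x \<in> Poly_Mapping.keys (?t p q)"
    using keys_sum by fast
  with p show ?thesis using that by (auto split: if_splits)
qed

context wf_digraph
begin

lemma path_end_in_verts: "p \<in> paths G \<Longrightarrow> path_end G p \<in> verts G"
  by (auto simp: paths_def path_end_def)

lemma path_start_in_verts: "p \<in> paths G \<Longrightarrow> fst p \<in> verts G"
  by (auto simp: paths_def)

lemma trivial_path: "(u, []) \<in> paths G \<longleftrightarrow> u \<in> verts G"
  by (auto simp: paths_def awalk_Nil_iff)

lemma paths_append:
  "\<lbrakk>p \<in> paths G; q \<in> paths G; path_end G p = fst q\<rbrakk> \<Longrightarrow> (fst p, snd p @ snd q) \<in> paths G"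
  by (auto simp: paths_def path_end_def)

end

text \<open>The kernel of \<open>\<phi>\<close> is given as a generated ideal; its minimality among
  ideals is available only once the path algebra is known to be a ring.\<close>

lemma (in fin_digraph) ring_path_algebra:
  "ring (path_algebra G :: (('a \<times> 'b list) \<Rightarrow>\<^sub>0 'k::field) ring)"
proof -
  let ?R = "path_algebra G :: (('a \<times> 'b list) \<Rightarrow>\<^sub>0 'k) ring"
  have one_left: "path_mult G (\<Sum>u\<in>verts G. path_elem (u, [])) f = f" if "f \<in> carrier ?R" for f :: "_ \<Rightarrow>\<^sub>0 'k"
  proof -
    have "Poly_Mapping.keys f \<subseteq> paths G" using that by (simp add: path_algebra_def)
    then show ?thesis
    proof (induction rule: poly_mapping_induct_keys)
      case (single p c)
      then have "fst p \<in> verts G" by (rule path_start_in_verts)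
      then show ?case by (simp add: path_mult_sum_left path_mult_single)
    qed (simp_all add: path_mult_add_right)
  qed
  have one_right: "path_mult G f (\<Sum>u\<in>verts G. path_elem (u, [])) = f" if "f \<in> carrier ?R" for f :: "_ \<Rightarrow>\<^sub>0 'k"
  proof -
    have "Poly_Mapping.keys f \<subseteq> paths G" using that by (simp add: path_algebra_def)
    then show ?thesis
    proof (induction rule: poly_mapping_induct_keys)
      case (single p c)
      then have "path_end G p \<in> verts G" by (rule path_end_in_verts)
      then show ?case by (simp add: path_mult_sum_right path_mult_single)
    qed (simp_all add: path_mult_add_left)
  qed
  have one_closed: "(\<Sum>u\<in>verts G. path_elem (u, []) :: _ \<Rightarrow>\<^sub>0 'k) \<in> carrier ?R"
    using keys_sum[of "\<lambda>u. path_elem (u, []) :: _ \<Rightarrow>\<^sub>0 'k" "verts G"] trivial_path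
    by (fastforce simp: path_algebra_def split: if_splits)
  have mult_closed: "path_mult G f g \<in> carrier ?R" if "f \<in> carrier ?R" "g \<in> carrier ?R" for f g :: "_ \<Rightarrow>\<^sub>0 'k"
    using that by (auto simp: path_algebra_def elim!: keys_path_multE intro!: paths_append)
  have "abelian_group ?R"
  proof (rule abelian_groupI)
    fix f assume "f \<in> carrier ?R"
    then show "\<exists>g\<in>carrier ?R. g \<oplus>\<^bsub>?R\<^esub> f = \<zero>\<^bsub>?R\<^esub>"
      by (intro bexI[of _ "- f"]) (auto simp: path_algebra_def)
  qed (simp_all add: path_algebra_def keys_add_subset ac_simps)
  moreover have "monoid ?R"
    using one_left one_right one_closed mult_closed
    by (intro monoidI) (simp_all add: path_mult_assoc path_algebra_def)
  ultimately show ?thesis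
    by (rule ringI) (simp_all add: path_algebra_def path_mult_add_left path_mult_add_right)
qed

text \<open>Source of monomial ideals. It is applied with \<open>B\<close> the set of paths killed
  by \<open>\<phi>\<close>, to bound the kernel from above.\<close>

lemma (in fin_digraph) ideal_supported_on:
  assumes "B \<subseteq> paths G"
    and right: "\<And>p q. \<lbrakk>p \<in> B; q \<in> paths G; path_end G p = fst q\<rbrakk> \<Longrightarrow> (fst p, snd p @ snd q) \<in> B"
    and left: "\<And>p q. \<lbrakk>p \<in> paths G; q \<in> B; path_end G p = fst q\<rbrakk> \<Longrightarrow> (fst p, snd p @ snd q) \<in> B"
  shows "ideal {f. Poly_Mapping.keys f \<subseteq> B} (path_algebra G :: (('a \<times> 'b list) \<Rightarrow>\<^sub>0 'k::field) ring)"
proof -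
  let ?R = "path_algebra G :: (('a \<times> 'b list) \<Rightarrow>\<^sub>0 'k) ring"
  interpret ring ?R by (rule ring_path_algebra)
  have minus: "\<ominus>\<^bsub>?R\<^esub> f = - f" if "Poly_Mapping.keys f \<subseteq> B" for f
    using that \<open>B \<subseteq> paths G\<close> by (intro minus_equality) (auto simp: path_algebra_def)
  show ?thesis
  proof (rule idealI)
    show "ring ?R" by (rule ring_path_algebra)
    show "subgroup {f. Poly_Mapping.keys f \<subseteq> B} (add_monoid ?R)"
    proof
      fix f assume "f \<in> {f :: _ \<Rightarrow>\<^sub>0 'k. Poly_Mapping.keys f \<subseteq> B}"
      then have "\<ominus>\<^bsub>?R\<^esub> f \<in> {f. Poly_Mapping.keys f \<subseteq> B}" using minus by simp
      then show "inv\<^bsub>add_monoid ?R\<^esub> f \<in> {f. Poly_Mapping.keys f \<subseteq> B}" by (simp add: a_inv_def)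
    qed (use \<open>B \<subseteq> paths G\<close> in \<open>auto simp: path_algebra_def dest: keys_add_subset[THEN subsetD]\<close>)
  next
    fix f g :: "_ \<Rightarrow>\<^sub>0 'k"
    assume "f \<in> {f. Poly_Mapping.keys f \<subseteq> B}" "g \<in> carrier ?R"
    then have fg: "Poly_Mapping.keys f \<subseteq> B" "Poly_Mapping.keys g \<subseteq> paths G"
      by (auto simp: path_algebra_def)
    show "f \<otimes>\<^bsub>?R\<^esub> g \<in> {f. Poly_Mapping.keys f \<subseteq> B}"
      using fg by (auto simp: path_algebra_def elim!: keys_path_multE intro!: right)
    show "g \<otimes>\<^bsub>?R\<^esub> f \<in> {f. Poly_Mapping.keys f \<subseteq> B}"
      using fg by (auto simp: path_algebra_def elim!: keys_path_multE intro!: left)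
  qed
qed

section \<open>Functional quivers\<close>

text \<open>Common form of the cyclic quiver, with \<open>tau\<close>, and of the resolution quiver,
  with \<open>gamma\<close>: one arrow leaves each vertex and is named after it.\<close>

definition functional_quiver :: "'v set \<Rightarrow> ('v \<Rightarrow> 'v) \<Rightarrow> ('v, 'v) pre_digraph" where
  "functional_quiver V g = \<lparr>verts = V, arcs = V, tail = (\<lambda>a. a), head = g\<rparr>"

lemma functional_quiver_simps [simp]:
  "verts (functional_quiver V g) = V" "arcs (functional_quiver V g) = V"
  "tail (functional_quiver V g) = (\<lambda>a. a)" "head (functional_quiver V g) = g"
  by (simp_all add: functional_quiver_def)

text \<open>The arrows of the walk of length \<open>m\<close> from \<open>u\<close>. With one arrow
  out of each vertex, start and length determine a walk.\<close>

definition orbit_list :: "('v \<Rightarrow> 'v) \<Rightarrow> 'v \<Rightarrow> nat \<Rightarrow> 'v list" where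
  "orbit_list g u m = map (\<lambda>j. (g ^^ j) u) [0..<m]"

lemma length_orbit_list [simp]: "length (orbit_list g u m) = m"
  by (simp add: orbit_list_def)

lemma orbit_list_0 [simp]: "orbit_list g u 0 = []"
  by (simp add: orbit_list_def)

lemma orbit_list_Suc: "orbit_list g u (Suc m) = u # orbit_list g (g u) m"
  by (simp add: orbit_list_def map_upt_Suc funpow_swap1 del: upt_Suc)

lemma orbit_list_add: "orbit_list g u (m + k) = orbit_list g u m @ orbit_list g ((g ^^ m) u) k"
  by (induction m arbitrary: u) (simp_all add: orbit_list_Suc funpow_swap1)

lemma set_orbit_list: "set (orbit_list g u m) = (\<lambda>j. (g ^^ j) u) ` {..<m}"
  by (auto simp: orbit_list_def)

lemma cas_functional_quiver:
  "pre_digraph.cas (functional_quiver V g) u es v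
    \<longleftrightarrow> es = orbit_list g u (length es) \<and> v = (g ^^ length es) u"
  by (induction es arbitrary: u)
    (auto simp: pre_digraph.cas.simps orbit_list_Suc funpow_swap1)

lemma awlast_functional_quiver:
  "pre_digraph.awlast (functional_quiver V g) u (orbit_list g u m) = (g ^^ m) u"
  by (induction m arbitrary: u)
    (simp_all add: orbit_list_Suc pre_digraph.awalk_verts.simps pre_digraph.awalk_verts_non_Nil funpow_swap1)

lemma funpow_closed: "\<lbrakk>\<And>a. a \<in> V \<Longrightarrow> g a \<in> V; u \<in> V\<rbrakk> \<Longrightarrow> (g ^^ m) u \<in> V"
  by (induction m) auto

lemma awalk_functional_quiver:
  assumes "\<And>a. a \<in> V \<Longrightarrow> g a \<in> V"
  shows "pre_digraph.awalk (functional_quiver V g) u es v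
    \<longleftrightarrow> u \<in> V \<and> es = orbit_list g u (length es) \<and> v = (g ^^ length es) u"
proof -
  have "set (orbit_list g u m) \<subseteq> V" if "u \<in> V" for m
    using funpow_closed[of V g, OF assms that] by (auto simp: set_orbit_list)
  then show ?thesis
    unfolding pre_digraph.awalk_def cas_functional_quiver by (auto, metis subsetD)
qed

lemma paths_functional_quiver:
  assumes "\<And>a. a \<in> V \<Longrightarrow> g a \<in> V"
  shows "paths (functional_quiver V g) = {(u, orbit_list g u m) | u m. u \<in> V}"
  unfolding paths_def using awalk_functional_quiver[of V g, OF assms]
  by auto

lemma path_end_functional_quiver [simp]:
  "path_end (functional_quiver V g) (u, orbit_list g u m) = (g ^^ m) u"
  by (simp add: path_end_def awlast_functional_quiver)

lemma fin_digraph_functional_quiver: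
  assumes "finite V" "\<And>a. a \<in> V \<Longrightarrow> g a \<in> V"
  shows "fin_digraph (functional_quiver V g)"
  by unfold_locales (use assms in auto)

lemma inj_on_funpow_least_period:
  assumes "(g ^^ l) u = u" and least: "\<And>j. \<lbrakk>0 < j; j < l\<rbrakk> \<Longrightarrow> (g ^^ j) u \<noteq> u"
  shows "inj_on (\<lambda>j. (g ^^ j) u) {..<l}"
proof (rule linorder_inj_onI)
  fix i j assume ij: "i < j" "i \<in> {..<l}" "j \<in> {..<l}"
  show "(g ^^ i) u \<noteq> (g ^^ j) u"
  proof
    assume "(g ^^ i) u = (g ^^ j) u"
    \<comment> \<open>Pushing both points forward by \<open>l - j\<close> brings the right one back
      to \<open>u\<close>, so \<open>l - j + i\<close> would be a return time below
      \<open>l\<close>.\<close>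
    then have "(g ^^ (l - j)) ((g ^^ i) u) = (g ^^ (l - j)) ((g ^^ j) u)" by simp
    then have "(g ^^ (l - j + i)) u = (g ^^ (l - j + j)) u" by (simp only: funpow_add o_apply)
    moreover have "l - j + j = l" "0 < l - j + i" "l - j + i < l" using ij by auto
    ultimately show False using assms(1) least by metis
  qed
qed auto

lemma cycle_functional_quiver:
  assumes "\<And>a. a \<in> V \<Longrightarrow> g a \<in> V"
  shows "pre_digraph.cycle (functional_quiver V g) es \<longleftrightarrow>
    (\<exists>u m. u \<in> V \<and> m > 0 \<and> es = orbit_list g u m \<and> (g ^^ m) u = u \<and> inj_on (\<lambda>j. (g ^^ j) u) {..<m})"
proof -
  \<comment> \<open>The vertex list of a closed walk is its orbit followed by \<open>u\<close>
    again. Dropping the head leaves a rotation of the orbit, so distinctness is injectivity on one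
    period.\<close>
  have verts: "distinct (tl (pre_digraph.awalk_verts (functional_quiver V g) u (orbit_list g u m)))
      \<longleftrightarrow> inj_on (\<lambda>j. (g ^^ j) u) {..<m}"
    if "(g ^^ m) u = u" "m > 0" for u m
  proof -
    obtain k where k: "m = Suc k" using \<open>m > 0\<close> by (cases m) auto
    have last: "g (last (orbit_list g u m)) = u"
      using that by (simp add: k orbit_list_def)
    have "orbit_list g u m \<noteq> []" using \<open>m > 0\<close> by (metis length_orbit_list length_0_conv neq0_conv)
    then have "tl (pre_digraph.awalk_verts (functional_quiver V g) u (orbit_list g u m))
        = tl (orbit_list g u m) @ [u]"
      by (simp add: pre_digraph.awalk_verts_conv last)
    moreover have "distinct (tl (orbit_list g u m) @ [u]) \<longleftrightarrow> distinct (orbit_list g u m)"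
      by (auto simp: k orbit_list_Suc)
    moreover have "distinct (orbit_list g u m) \<longleftrightarrow> inj_on (\<lambda>j. (g ^^ j) u) {..<m}"
      by (simp add: orbit_list_def distinct_map lessThan_atLeast0)
    ultimately show ?thesis by simp
  qed
  show ?thesis
  proof
    assume "pre_digraph.cycle (functional_quiver V g) es"
    then obtain u where u: "pre_digraph.awalk (functional_quiver V g) u es u" "es \<noteq> []"
        "distinct (tl (pre_digraph.awalk_verts (functional_quiver V g) u es))"
      unfolding pre_digraph.cycle_def by blast
    from u(1) have "u \<in> V" "es = orbit_list g u (length es)" "(g ^^ length es) u = u"
      by (simp_all add: awalk_functional_quiver[of V g, OF assms])
    with u verts[of "length es" u]
    show "\<exists>u m. u \<in> V \<and> m > 0 \<and> es = orbit_list g u m \<and> (g ^^ m) u = u \<and> inj_on (\<lambda>j. (g ^^ j) u) {..<m}"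
      by (metis length_greater_0_conv)
  next
    assume "\<exists>u m. u \<in> V \<and> m > 0 \<and> es = orbit_list g u m \<and> (g ^^ m) u = u \<and> inj_on (\<lambda>j. (g ^^ j) u) {..<m}"
    then obtain u m where u: "u \<in> V" "m > 0" "es = orbit_list g u m" "(g ^^ m) u = u"
      "inj_on (\<lambda>j. (g ^^ j) u) {..<m}" by blast
    then have "pre_digraph.awalk (functional_quiver V g) u es u" "es \<noteq> []"
      by (auto simp: awalk_functional_quiver[of V g, OF assms] simp flip: length_greater_0_conv)
    then show "pre_digraph.cycle (functional_quiver V g) es"
      using verts[of m u] u unfolding pre_digraph.cycle_def by auto
  qed
qed

lemma eventually_periodic:
  fixes g :: "'v \<Rightarrow> 'v"
  assumes "finite V" "\<And>a. a \<in> V \<Longrightarrow> g a \<in> V" "u \<in> V"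
  obtains k l where "l > 0" "(g ^^ l) ((g ^^ k) u) = (g ^^ k) u"
proof -
  have "(\<lambda>k. (g ^^ k) u) ` UNIV \<subseteq> V" using funpow_closed[of V g, OF assms(2,3)] by auto
  then have "\<not> inj (\<lambda>k. (g ^^ k) u)"
    using \<open>finite V\<close> finite_subset finite_imageD infinite_UNIV_nat by blast
  then obtain i j where "i < j" "(g ^^ i) u = (g ^^ j) u"
    unfolding inj_def by (metis linorder_neqE_nat)
  moreover have "(g ^^ (j - i)) ((g ^^ i) u) = (g ^^ (j - i + i)) u" by (simp only: funpow_add o_apply)
  ultimately show thesis using that[of "j - i" i] by simp
qed

text \<open>A zigzag can be straightened: that two forward orbits meet is preserved when an endpoint
  moves along an arrow in either direction, at the price of one more application of
  \<open>g\<close>.\<close>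

lemma reachable_functional_quiver:
  assumes fin: "finite V" and closed: "\<And>a. a \<in> V \<Longrightarrow> g a \<in> V" and "u \<in> V"
  shows "u \<rightarrow>\<^sup>*\<^bsub>with_proj (mk_symmetric (functional_quiver V g))\<^esub> v
    \<longleftrightarrow> v \<in> V \<and> (\<exists>k l. (g ^^ k) u = (g ^^ l) v)"
proof -
  let ?G = "functional_quiver V g" let ?H = "with_proj (mk_symmetric ?G)"
  interpret G: fin_digraph ?G using fin closed by (rule fin_digraph_functional_quiver)
  interpret H: pair_fin_digraph "mk_symmetric ?G" by (rule G.pair_fin_digraph_mk_symmetric)
  have step: "(x, g x) \<in> parcs (mk_symmetric ?G)" "(g x, x) \<in> parcs (mk_symmetric ?G)" if "x \<in> V" for x
    using that by (auto simp: parcs_mk_symmetric)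
  have orbit: "x \<rightarrow>\<^sup>*\<^bsub>?H\<^esub> (g ^^ k) x \<and> (g ^^ k) x \<rightarrow>\<^sup>*\<^bsub>?H\<^esub> x" if "x \<in> V" for x k
  proof (induction k)
    case (Suc k)
    have y: "(g ^^ k) x \<in> V" using closed that by (rule funpow_closed)
    have "(g ^^ k) x \<rightarrow>\<^sup>*\<^bsub>?H\<^esub> (g ^^ Suc k) x" "(g ^^ Suc k) x \<rightarrow>\<^sup>*\<^bsub>?H\<^esub> (g ^^ k) x"
      using step[OF y] by (auto intro!: H.reachable_adjI)
    with Suc show ?case by (blast intro: H.reachable_trans)
  qed (use that in auto)
  show ?thesis
  proof
    assume "u \<rightarrow>\<^sup>*\<^bsub>?H\<^esub> v"
    then show "v \<in> V \<and> (\<exists>k l. (g ^^ k) u = (g ^^ l) v)"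
    proof (induction rule: H.reachable_induct)
      case base
      with \<open>u \<in> V\<close> show ?case by blast
    next
      case (step x y)
      then obtain k l where kl: "(g ^^ k) u = (g ^^ l) x" by blast
      from step have "y \<in> V" "(y = g x \<or> x = g y)"
        using closed by (auto simp: parcs_mk_symmetric)
      moreover from kl have "(g ^^ Suc k) u = (g ^^ l) (g x)" by (simp add: funpow_swap1)
      moreover from kl have "(g ^^ k) u = (g ^^ Suc l) y" if "x = g y" using that by (simp add: funpow_swap1)
      ultimately show ?case by blast
    qed
  next
    assume "v \<in> V \<and> (\<exists>k l. (g ^^ k) u = (g ^^ l) v)"
    then show "u \<rightarrow>\<^sup>*\<^bsub>?H\<^esub> v"
      using orbit \<open>u \<in> V\<close> by (metis H.reachable_trans)
  qed
qed

text \<open>Every forward orbit in a finite set ends in a cycle, and within a component forward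
  orbits meet, so each component contains exactly one cycle. One periodic vertex per component is
  therefore one vertex per cycle.\<close>

lemma component_representatives:
  fixes g :: "'v \<Rightarrow> 'v"
  assumes fin: "finite V" and closed: "\<And>a. a \<in> V \<Longrightarrow> g a \<in> V"
  obtains S where "S \<subseteq> V"
    "card S = card (pre_digraph.sccs (with_proj (mk_symmetric (functional_quiver V g))))"
    "\<And>r. r \<in> S \<Longrightarrow> \<exists>l>0. (g ^^ l) r = r"
    "\<And>r j. \<lbrakk>r \<in> S; (g ^^ j) r \<in> S\<rbrakk> \<Longrightarrow> (g ^^ j) r = r"
    "\<And>i. i \<in> V \<Longrightarrow> \<exists>k. (g ^^ k) i \<in> S"
proof -
  let ?G = "functional_quiver V g" let ?H = "with_proj (mk_symmetric ?G)"
  interpret G: fin_digraph ?G using fin closed by (rule fin_digraph_functional_quiver)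
  interpret H: pair_fin_digraph "mk_symmetric ?G" by (rule G.pair_fin_digraph_mk_symmetric)
  define cl where "cl u = {v \<in> V. \<exists>k l. (g ^^ k) u = (g ^^ l) v}" for u
  have scc: "H.scc_of u = cl u" if "u \<in> V" for u
    using reachable_functional_quiver[of V g, OF fin closed] that
    by (auto simp: H.scc_of_def cl_def) metis+
  have cl_funpow: "(g ^^ k) u \<in> cl u" if "u \<in> V" for u k
  proof -
    have "(g ^^ k) u = (g ^^ 0) ((g ^^ k) u)" by simp
    then show ?thesis unfolding cl_def using funpow_closed[of V g, OF closed that] by blast
  qed
  have card_cl: "card (cl ` V) = card H.sccs"
    using H.card_sccs_verts H.sccs_verts_conv_scc_of scc by simp
  have cl_eq: "cl v = cl u" if v: "v \<in> cl u" and u: "u \<in> V" for u v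
  proof -
    have "v \<in> V" using v by (simp add: cl_def)
    with u have "cl u \<in> H.sccs_verts" "cl v \<in> H.sccs_verts" "v \<in> cl v"
      using H.scc_of_in_sccs_verts H.in_scc_of_self scc by force+
    with v H.sccs_verts_disjoint show ?thesis by blast
  qed
  \<comment> \<open>The choice depends on the class and not on a vertex of it, so that all vertices
    of a component share their representative.\<close>
  define rep where "rep X = (SOME v. v \<in> X \<and> (\<exists>l>0. (g ^^ l) v = v))" for X
  have rep: "rep (cl u) \<in> cl u \<and> (\<exists>l>0. (g ^^ l) (rep (cl u)) = rep (cl u))" if u: "u \<in> V" for u
    unfolding rep_def
  proof (rule someI_ex)
    obtain k l where "l > 0" "(g ^^ l) ((g ^^ k) u) = (g ^^ k) u"
      using eventually_periodic[of V g, OF fin closed u] .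
    with cl_funpow[OF u] show "\<exists>v. v \<in> cl u \<and> (\<exists>l>0. (g ^^ l) v = v)" by blast
  qed
  have cl_rep: "cl (rep (cl u)) = cl u" if "u \<in> V" for u using cl_eq rep that by blast
  show thesis
  proof
    show "rep ` cl ` V \<subseteq> V" using rep by (auto simp: cl_def)
    have "inj_on rep (cl ` V)" by (rule inj_on_inverseI[where g = cl]) (use cl_rep in auto)
    then show "card (rep ` cl ` V) = card H.sccs" using card_cl by (simp add: card_image)
    show "\<exists>l>0. (g ^^ l) r = r" if "r \<in> rep ` cl ` V" for r using that rep by auto
    show "(g ^^ j) r = r" if r: "r \<in> rep ` cl ` V" and j: "(g ^^ j) r \<in> rep ` cl ` V" for r j
    proof -
      from r have r': "r \<in> V" "r = rep (cl r)" using rep cl_rep by (auto simp: cl_def)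
      from j have "(g ^^ j) r = rep (cl ((g ^^ j) r))" using cl_rep by auto
      also have "cl ((g ^^ j) r) = cl r" using r' by (intro cl_eq cl_funpow)
      finally show ?thesis using r' by simp
    qed
    show "\<exists>k. (g ^^ k) i \<in> rep ` cl ` V" if i: "i \<in> V" for i
    proof -
      define r where "r = rep (cl i)"
      have "r \<in> cl i" and "\<exists>m>0. (g ^^ m) r = r" using rep[OF i] by (auto simp: r_def)
      then obtain k l m where kl: "(g ^^ k) i = (g ^^ l) r" and m: "m > 0" "(g ^^ m) r = r"
        by (auto simp: cl_def)
      \<comment> \<open>The orbit of \<open>i\<close> meets that of \<open>r\<close> at time
        \<open>l\<close>; going on to time \<open>m * l\<close>, a multiple of the period of
        \<open>r\<close>, closes the turn at \<open>r\<close> itself.\<close>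
      have "(g ^^ (m * l - l)) ((g ^^ l) r) = (g ^^ (m * l - l + l)) r" by (simp add: funpow_add)
      also have "m * l - l + l = m * l" using m by simp
      also have "(g ^^ (m * l)) r = r"
        using m(2) by (induction l) (simp_all add: funpow_add)
      finally have "(g ^^ (m * l - l + k)) i = r" by (simp add: funpow_add kl)
      then show ?thesis using i by (auto simp: r_def)
    qed
  qed
qed

section \<open>Nakayama algebras\<close>

lemma cyclic_quiver_eq: "cyclic_quiver n = functional_quiver {1..n} (tau n)"
  by (simp add: cyclic_quiver_def functional_quiver_def)

lemma tau_closed: "a \<in> {1..n} \<Longrightarrow> tau n a \<in> {1..n}"
  by (auto simp: tau_def)

lemma downward_closed_eq_lessThan_card:
  fixes M :: "nat set"
  assumes "finite M" "\<And>m k. \<lbrakk>m \<in> M; k \<le> m\<rbrakk> \<Longrightarrow> k \<in> M"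
  shows "M = {..<card M}"
proof (cases "M = {}")
  case False
  with assms(1) have "Max M \<in> M" by (rule Max_in)
  then have "M = {..Max M}" using assms by (auto dest: Max_ge)
  then show ?thesis by (metis card_atMost lessThan_Suc_atMost)
qed simp

section \<open>Specialisation of polynomials, Laurent monomials and diagonal conjugation\<close>

lemma map_poly_of_int_add:
  "map_poly (of_int :: int \<Rightarrow> 'a::comm_ring_1) (P + Q) = map_poly of_int P + map_poly of_int Q"
  by (rule poly_eqI) (simp add: coeff_map_poly)

lemma map_poly_of_int_mult:
  "map_poly (of_int :: int \<Rightarrow> 'a::comm_ring_1) (P * Q) = map_poly of_int P * map_poly of_int Q"
  by (rule poly_eqI) (simp add: coeff_map_poly coeff_mult)

text \<open>The specialisation of the variable s. Being a ring homomorphism, it commutes with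
  determinants.\<close>

lemma comm_ring_hom_poly_map_of_int:
  "comm_ring_hom (\<lambda>P :: int poly. poly (map_poly of_int P) (x :: 'a::comm_ring_1))"
  by unfold_locales (simp_all add: map_poly_of_int_add map_poly_of_int_mult)

lemma poly_map_of_int:
  "poly (map_poly of_int P) (of_int x :: 'a::comm_ring_1) = of_int (poly P x)"
  by (induction P) (simp_all add: map_poly_pCons)

lemma tpow_power: "tpow d ^ k = tpow (d * int k)"
  by (induction k) (simp_all add: mult_single algebra_simps)

text \<open>Passes from a generating function indexed by degrees to one monomial per path.\<close>

lemma sum_single_card_fibre:
  assumes "finite M"
  shows "(\<Sum>l | card {m \<in> M. g m = l} \<noteq> 0. Poly_Mapping.single l (int (card {m \<in> M. g m = l})))
    = (\<Sum>m\<in>M. tpow (g m))"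
proof -
  have "{l. card {m \<in> M. g m = l} \<noteq> 0} = g ` M" using assms by auto
  moreover have "Poly_Mapping.single l (int k) = of_nat k * tpow l" for l k
    by (induction k) (simp_all add: single_add algebra_simps)
  ultimately have "(\<Sum>l | card {m \<in> M. g m = l} \<noteq> 0. Poly_Mapping.single l (int (card {m \<in> M. g m = l})))
      = (\<Sum>l\<in>g ` M. \<Sum>m | m \<in> M \<and> g m = l. tpow (g m))"
    by (intro sum.cong) auto
  also have "\<dots> = (\<Sum>m\<in>M. tpow (g m))"
    by (rule sum.group) (use assms in auto)
  finally show ?thesis .
qed

text \<open>In each term of the Leibniz expansion every \<open>s i\<close> and every
  \<open>s' i\<close> occurs exactly once, and they cancel.\<close>

lemma det_diagonal_conjugate:
  fixes A B :: "'a::comm_ring_1 mat"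
  assumes A: "A \<in> carrier_mat n n" and B: "B \<in> carrier_mat n n"
    and inverse: "\<And>i. s i * s' i = 1"
    and entry: "\<And>i j. \<lbrakk>i < n; j < n\<rbrakk> \<Longrightarrow> A $$ (i, j) = s i * s' j * B $$ (i, j)"
  shows "det A = det B"
  unfolding det_def'[OF A] det_def'[OF B]
proof (intro sum.cong refl arg_cong2[where f = "(*)"])
  fix p assume "p \<in> {p. p permutes {0..<n}}"
  then have p: "p permutes {0..<n}" by simp
  have "(\<Prod>i = 0..<n. A $$ (i, p i)) = (\<Prod>i = 0..<n. s i * s' (p i) * B $$ (i, p i))"
    using permutes_in_image[OF p] by (intro prod.cong) (auto intro!: entry)
  also have "\<dots> = (\<Prod>i = 0..<n. s i) * (\<Prod>i = 0..<n. s' (p i)) * (\<Prod>i = 0..<n. B $$ (i, p i))"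
    by (simp add: prod.distrib)
  also have "(\<Prod>i = 0..<n. s' (p i)) = (\<Prod>i = 0..<n. s' i)"
    using prod.permute[OF p, of s'] by (simp add: o_def)
  also have "(\<Prod>i = 0..<n. s i) * (\<Prod>i = 0..<n. s' i) = 1"
    by (simp add: inverse flip: prod.distrib)
  finally show "(\<Prod>i = 0..<n. A $$ (i, p i)) = (\<Prod>i = 0..<n. B $$ (i, p i))" by simp
qed

context nakayama_algebra
begin

section \<open>The basis of paths with nonzero image\<close>

abbreviation "Q \<equiv> cyclic_quiver n"
abbreviation PA :: "((nat \<times> nat list) \<Rightarrow>\<^sub>0 'k) ring" where "PA \<equiv> path_algebra Q"

definition pth :: "nat \<times> nat list \<Rightarrow> 'a" where
  "pth p = \<phi> (path_elem p)"

definition nonzero_paths :: "(nat \<times> nat list) set" where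
  "nonzero_paths = {p \<in> paths Q. pth p \<noteq> 0}"

sublocale quiver: fin_digraph Q
  unfolding cyclic_quiver_eq by (rule fin_digraph_functional_quiver) (use tau_closed in auto)

lemma carrier_PA: "carrier PA = {f. Poly_Mapping.keys f \<subseteq> paths Q}"
  by (simp add: path_algebra_def)

lemma phi_zero: "\<phi> 0 = 0"
  using phi_add[of 0 0] by (simp add: carrier_PA)

lemma phi_single: "p \<in> paths Q \<Longrightarrow> \<phi> (Poly_Mapping.single p c) = scale c (pth p)"
  using phi_scale[of "path_elem p" c] by (simp add: carrier_PA pth_def)

lemma phi_sum:
  "(\<And>i. i \<in> I \<Longrightarrow> h i \<in> carrier PA) \<Longrightarrow> \<phi> (sum h I) = (\<Sum>i\<in>I. \<phi> (h i))"
proof (induction I rule: infinite_finite_induct)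
  case (insert i I)
  have "sum h I \<in> carrier PA"
    using insert.prems keys_sum[of h I] by (fastforce simp: carrier_PA)
  with insert show ?case by (simp add: phi_add)
qed (simp_all add: phi_zero)

lemma pth_mult:
  assumes "p \<in> paths Q" "q \<in> paths Q"
  shows "pth p * pth q = (if path_end Q p = fst q then pth (fst p, snd p @ snd q) else 0)"
proof -
  have "pth p * pth q = \<phi> (path_mult Q (path_elem p) (path_elem q))"
    using phi_mult[of "path_elem p" "path_elem q"] assms
    by (simp add: pth_def carrier_PA path_algebra_def)
  then show ?thesis by (simp add: path_mult_single pth_def phi_zero)
qed

text \<open>
  The relations are paths, so the combinations of paths killed by \<open>\<phi>\<close> already form an ideal
  containing them; hence the kernel is spanned by paths.
\<close>

lemma keys_kernel:
  assumes "Poly_Mapping.keys f \<subseteq> paths Q" "\<phi> f = 0" "p \<in> Poly_Mapping.keys f"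
  shows "pth p = 0"
proof -
  interpret PA: ring PA by (rule quiver.ring_path_algebra)
  let ?B = "{p \<in> paths Q. pth p = 0}"
  have rels: "path_elem ` rels \<subseteq> carrier PA" using rels_paths by (auto simp: carrier_PA)
  have "r \<in> ?B" if "r \<in> rels" for r
  proof -
    have "path_elem r \<in> {f \<in> carrier PA. \<phi> f = 0}"
      unfolding phi_kernel using PA.genideal_self[OF rels] that by blast
    then have "pth r = 0" by (simp add: pth_def)
    then show ?thesis using rels_paths that by blast
  qed
  then have sub: "path_elem ` rels \<subseteq> {f. Poly_Mapping.keys f \<subseteq> ?B}"
    by (simp add: image_subset_iff)
  have "ideal {f. Poly_Mapping.keys f \<subseteq> ?B} PA"
  proof (rule quiver.ideal_supported_on)
    fix p q assume "p \<in> ?B" "q \<in> paths Q" "path_end Q p = fst q"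
    then show "(fst p, snd p @ snd q) \<in> ?B"
      using pth_mult[of p q] quiver.paths_append[of p q] by simp
  next
    fix p q assume "p \<in> paths Q" "q \<in> ?B" "path_end Q p = fst q"
    then show "(fst p, snd p @ snd q) \<in> ?B"
      using pth_mult[of p q] quiver.paths_append[of p q] by simp
  qed simp
  from PA.genideal_minimal[OF this sub]
  have "{f \<in> carrier PA. \<phi> f = 0} \<subseteq> {f. Poly_Mapping.keys f \<subseteq> ?B}" unfolding phi_kernel .
  moreover have "f \<in> {f \<in> carrier PA. \<phi> f = 0}" using assms by (simp add: carrier_PA)
  ultimately have "Poly_Mapping.keys f \<subseteq> ?B" by blast
  with assms(3) show ?thesis by blast
qed

text \<open>A linear relation lifts to an element of the kernel of \<open>\<phi>\<close>, and the
  support of such an element consists of killed paths.\<close>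

lemma nonzero_paths_lin_indep:
  assumes "finite F" "F \<subseteq> nonzero_paths" "(\<Sum>p\<in>F. scale (u p) (pth p)) = 0" "p \<in> F"
  shows "u p = 0"
proof (rule ccontr)
  assume "u p \<noteq> 0"
  let ?f = "\<Sum>p\<in>F. Poly_Mapping.single p (u p)"
  have F: "F \<subseteq> paths Q" using assms by (auto simp: nonzero_paths_def)
  then have "\<phi> ?f = (\<Sum>p\<in>F. scale (u p) (pth p))"
    by (subst phi_sum) (auto simp: carrier_PA phi_single intro!: sum.cong)
  moreover have "Poly_Mapping.keys ?f \<subseteq> paths Q"
    by (rule order_trans[OF keys_sum]) (use F in auto)
  moreover have "p \<in> Poly_Mapping.keys ?f"
    using assms \<open>u p \<noteq> 0\<close> by (simp add: in_keys_iff lookup_sum lookup_single when_def)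
  ultimately have "pth p = 0" using keys_kernel[of ?f p] assms(3) by simp
  then show False using assms by (auto simp: nonzero_paths_def)
qed

text \<open>\<open>independent\<close> speaks of the set of images and would not notice two paths
  with the same image; the indexed form of independence excludes this.\<close>

lemma inj_on_pth: "inj_on pth nonzero_paths"
proof (rule inj_onI, rule ccontr)
  fix p q assume pq: "p \<in> nonzero_paths" "q \<in> nonzero_paths" "pth p = pth q" "p \<noteq> q"
  let ?u = "\<lambda>r. if r = p then 1 else -1 :: 'k"
  have "(\<Sum>r\<in>{p, q}. scale (?u r) (pth r)) = 0" using pq by simp
  then have "?u p = 0" by (rule nonzero_paths_lin_indep[rotated 2]) (use pq in auto)
  then show False by simp
qed

lemma independent_nonzero_paths: "independent (pth ` nonzero_paths)"
  unfolding independent_explicit_module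
proof (intro allI impI)
  fix t u v assume t: "finite t" "t \<subseteq> pth ` nonzero_paths" "(\<Sum>v\<in>t. scale (u v) v) = 0" "v \<in> t"
  then obtain F where F: "F \<subseteq> nonzero_paths" "finite F" "t = pth ` F"
    using finite_subset_image[OF t(1,2)] by blast
  have "(\<Sum>p\<in>F. scale (u (pth p)) (pth p)) = (\<Sum>v\<in>t. scale (u v) v)"
    unfolding F(3) sum.reindex[OF inj_on_subset[OF inj_on_pth F(1)]] by simp
  then have "(\<Sum>p\<in>F. scale (u (pth p)) (pth p)) = 0" by (simp only: t(3))
  moreover obtain p where "p \<in> F" "v = pth p" using t(4) unfolding F(3) by blast
  ultimately show "u v = 0" using nonzero_paths_lin_indep[of F "\<lambda>p. u (pth p)" p] F by simp
qed

lemma span_paths: "span (pth ` paths Q) = UNIV"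
proof -
  have "\<phi> f \<in> span (pth ` paths Q)" if "f \<in> carrier PA" for f
    using that unfolding carrier_PA mem_Collect_eq
  proof (induction rule: poly_mapping_induct_keys)
    case (single p c)
    then show ?case by (simp add: phi_single span_scale span_base)
  next
    case (add f g)
    then show ?case by (simp add: phi_add carrier_PA span_add)
  qed (simp add: phi_zero span_zero)
  then have "\<phi> ` carrier PA \<subseteq> span (pth ` paths Q)" by blast
  then show ?thesis unfolding phi_surj by blast
qed

lemma finite_nonzero_paths: "finite nonzero_paths"
proof -
  obtain B where "finite B" "span B = UNIV" using finite_dimensional by blast
  then have "finite (pth ` nonzero_paths)"
    using independent_span_bound[OF _ independent_nonzero_paths, of B] by simp
  then show ?thesis by (rule finite_imageD[OF _ inj_on_pth])
qed

text \<open>Serves both dimension counts: multiplication by idempotents, on one side for a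
  projective and on both for a Cartan entry, fixes or kills each path, so the fixed paths with
  nonzero image are a basis of the result.\<close>

lemma dim_image_of_paths:
  assumes h: "module_hom scale scale h" and "X \<subseteq> paths Q" "Y \<subseteq> X"
    and "\<And>p. p \<in> Y \<Longrightarrow> h (pth p) = pth p" "\<And>p. p \<in> X - Y \<Longrightarrow> h (pth p) = 0"
  shows "dim (h ` span (pth ` X)) = card (Y \<inter> nonzero_paths)"
proof -
  interpret module_hom scale scale h by (rule h)
  let ?N = "pth ` (Y \<inter> nonzero_paths)"
  have "h (pth p) \<in> insert 0 ?N" if "p \<in> X" for p
  proof (cases "p \<in> Y \<inter> nonzero_paths")
    case True
    then show ?thesis using assms(4)[of p] by simp
  next
    case False
    then have "h (pth p) = 0"
      using assms(2) assms(4,5)[of p] that by (cases "p \<in> Y") (auto simp: nonzero_paths_def)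
    then show ?thesis by simp
  qed
  then have "h ` pth ` X \<subseteq> insert 0 ?N" by blast
  moreover have "pth p \<in> h ` pth ` X" if "p \<in> Y" for p
    using assms(3) assms(4)[OF that] that by (metis image_eqI subsetD)
  then have "?N \<subseteq> h ` pth ` X" by blast
  ultimately have "span (h ` pth ` X) = span ?N"
    using span_mono[of ?N "h ` pth ` X"] span_mono[of "h ` pth ` X" "insert 0 ?N"] by simp
  then have "dim (span (h ` pth ` X)) = dim ?N" by (metis dim_span)
  also have "independent ?N" by (rule independent_mono[OF independent_nonzero_paths]) auto
  then have "dim ?N = card ?N" by (rule dim_eq_card_independent)
  also have "card ?N = card (Y \<inter> nonzero_paths)"
    by (rule card_image) (rule inj_on_subset[OF inj_on_pth], auto)
  finally show ?thesis unfolding span_image .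
qed

lemma module_hom_mult: "module_hom scale scale (\<lambda>x. y * x * z)"
  by unfold_locales
    (simp_all only: scale_mult_left scale_mult_right distrib_left distrib_right)

lemma trivial_path_Q: "a \<in> {1..n} \<Longrightarrow> (a, []) \<in> paths Q"
  using quiver.trivial_path[of a] by (simp add: cyclic_quiver_def)

lemma idem_mult_pth:
  assumes "a \<in> {1..n}" "p \<in> paths Q"
  shows "idem a * pth p = (if fst p = a then pth p else 0)"
  using pth_mult[OF trivial_path_Q[OF assms(1)] assms(2)] by (auto simp: idem_def simp flip: pth_def)

lemma pth_mult_idem:
  assumes "a \<in> {1..n}" "p \<in> paths Q"
  shows "pth p * idem a = (if path_end Q p = a then pth p else 0)"
  using pth_mult[OF assms(2) trivial_path_Q[OF assms(1)]] by (auto simp: idem_def simp flip: pth_def)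

section \<open>Projectives and Cartan entries in terms of walk lengths\<close>

abbreviation walk :: "nat \<Rightarrow> nat \<Rightarrow> nat \<times> nat list" where
  "walk a m \<equiv> (a, orbit_list (tau n) a m)"

lemma paths_Q: "paths Q = {walk a m | a m. a \<in> {1..n}}"
  unfolding cyclic_quiver_eq by (rule paths_functional_quiver) (rule tau_closed)

lemma walk_in_paths: "a \<in> {1..n} \<Longrightarrow> walk a m \<in> paths Q"
  by (auto simp: paths_Q)

lemma path_end_walk: "path_end Q (walk a m) = (tau n ^^ m) a"
  by (simp add: cyclic_quiver_eq)

lemma inj_walk: "inj_on (walk a) M"
  by (rule inj_on_inverseI[where g = "length \<circ> snd"]) simp

lemma pth_walk_add:
  assumes "a \<in> {1..n}"
  shows "pth (walk a (m + k)) = pth (walk a m) * pth (walk ((tau n ^^ m) a) k)"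
  using pth_mult[of "walk a m" "walk ((tau n ^^ m) a) k"] assms
    funpow_closed[of "{1..n}" "tau n", OF tau_closed assms]
  by (simp add: walk_in_paths path_end_walk orbit_list_add)

lemma proj_dim_eq: "a \<in> {1..n} \<Longrightarrow> proj_dim a = card {m. pth (walk a m) \<noteq> 0}"
proof -
  assume a: "a \<in> {1..n}"
  \<comment> \<open>The right factor \<open>1\<close> brings left multiplication into the two-sided
    form of \<open>module_hom_mult\<close>.\<close>
  have "proj a = (\<lambda>x. idem a * x * 1) ` span (pth ` paths Q)"
    by (auto simp: proj_def span_paths)
  then have "proj_dim a = card ({p \<in> paths Q. fst p = a} \<inter> nonzero_paths)"
    unfolding proj_dim_def
    by (simp only:) (rule dim_image_of_paths[OF module_hom_mult], use a idem_mult_pth in auto)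
  also have "{p \<in> paths Q. fst p = a} \<inter> nonzero_paths = walk a ` {m. pth (walk a m) \<noteq> 0}"
    using a by (auto simp: nonzero_paths_def paths_Q)
  also have "card \<dots> = card {m. pth (walk a m) \<noteq> 0}" by (rule card_image[OF inj_walk])
  finally show ?thesis .
qed

text \<open>A prefix of a nonzero path is nonzero, so the lengths that survive form an initial
  segment, and the dimension of the projective is its size.\<close>

lemma pth_walk_nonzero_iff:
  assumes a: "a \<in> {1..n}"
  shows "pth (walk a m) \<noteq> 0 \<longleftrightarrow> m < proj_dim a"
proof -
  let ?M = "{m. pth (walk a m) \<noteq> 0}"
  have "walk a ` ?M \<subseteq> nonzero_paths" using a by (auto simp: nonzero_paths_def walk_in_paths)
  then have "finite ?M" using finite_subset[OF _ finite_nonzero_paths] finite_imageD[OF _ inj_walk] by blast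
  moreover have "k \<in> ?M" if "m \<in> ?M" "k \<le> m" for m k
    using pth_walk_add[OF a, of k "m - k"] that by auto
  ultimately have "?M = {..<card ?M}" by (rule downward_closed_eq_lessThan_card)
  then show ?thesis unfolding proj_dim_eq[OF a] by blast
qed

text \<open>Removing the first arrow of a nonzero path leaves a nonzero path from the next vertex.
  This inequality is what makes \<open>gamma_lift\<close> monotone.\<close>

lemma proj_dim_le_tau:
  assumes a: "a \<in> {1..n}"
  shows "proj_dim a \<le> Suc (proj_dim (tau n a))"
proof (rule ccontr)
  assume "\<not> ?thesis"
  then have "pth (walk a (1 + proj_dim (tau n a))) \<noteq> 0" using pth_walk_nonzero_iff[OF a] by simp
  then have "pth (walk (tau n a) (proj_dim (tau n a))) \<noteq> 0"
    using pth_walk_add[OF a, of 1 "proj_dim (tau n a)"] by auto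
  then show False using pth_walk_nonzero_iff[OF tau_closed[OF a]] by simp
qed

text \<open>As \<open>idem b\<close> multiplies from the left, column \<open>b\<close> of the Cartan
  matrix collects the walks that start at \<open>b\<close>; this makes it an interval on the
  cover.\<close>

lemma cartan_dim_eq:
  assumes a: "a \<in> {1..n}" and b: "b \<in> {1..n}"
  shows "cartan_dim \<d> a b l
    = card {m \<in> {..<proj_dim b}. (tau n ^^ m) b = a \<and> (\<Sum>j<m. \<d> ((tau n ^^ j) b)) = l}"
proof -
  let ?X = "{p \<in> paths Q. path_degree \<d> p = l}"
  let ?Y = "{p \<in> ?X. fst p = b \<and> path_end Q p = a}"
  have deg: "path_degree \<d> (walk b m) = (\<Sum>j<m. \<d> ((tau n ^^ j) b))" for m
    by (simp add: path_degree_def orbit_list_def o_def interv_sum_list_conv_sum_set_nat lessThan_atLeast0)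
  have zero_iff: "pth (walk b m) = 0 \<longleftrightarrow> \<not> m < proj_dim b" for m
    using pth_walk_nonzero_iff[OF b, of m] by blast
  have "{idem b * x * idem a | x. x \<in> degree_part \<d> l} = (\<lambda>x. idem b * x * idem a) ` span (pth ` ?X)"
  proof -
    have "{\<phi> (path_elem p) | p. p \<in> paths Q \<and> path_degree \<d> p = l} = pth ` ?X"
      by (auto simp: pth_def)
    then show ?thesis unfolding degree_part_def by (simp only: Setcompr_eq_image)
  qed
  then have "cartan_dim \<d> a b l = card (?Y \<inter> nonzero_paths)"
    unfolding cartan_dim_def
    by (simp only:) (rule dim_image_of_paths[OF module_hom_mult],
      use a b in \<open>auto simp: idem_mult_pth pth_mult_idem\<close>)
  also have "?Y \<inter> nonzero_paths
      = walk b ` {m \<in> {..<proj_dim b}. (tau n ^^ m) b = a \<and> (\<Sum>j<m. \<d> ((tau n ^^ j) b)) = l}"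
  proof (intro Set.set_eqI iffI)
    fix p assume "p \<in> ?Y \<inter> nonzero_paths"
    then obtain m where "p = walk b m" "pth p \<noteq> 0" "path_degree \<d> p = l" "path_end Q p = a"
      by (auto simp: nonzero_paths_def paths_Q)
    then show "p \<in> walk b ` {m \<in> {..<proj_dim b}. (tau n ^^ m) b = a \<and> (\<Sum>j<m. \<d> ((tau n ^^ j) b)) = l}"
      by (simp add: zero_iff path_end_walk deg)
  next
    fix p assume "p \<in> walk b ` {m \<in> {..<proj_dim b}. (tau n ^^ m) b = a \<and> (\<Sum>j<m. \<d> ((tau n ^^ j) b)) = l}"
    then show "p \<in> ?Y \<inter> nonzero_paths"
      using walk_in_paths[OF b] by (auto simp: nonzero_paths_def zero_iff path_end_walk deg)
  qed
  also have "card \<dots> = card {m \<in> {..<proj_dim b}. (tau n ^^ m) b = a \<and> (\<Sum>j<m. \<d> ((tau n ^^ j) b)) = l}"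
    by (rule card_image[OF inj_walk])
  finally show ?thesis .
qed

section \<open>The lift of the resolution quiver to the cover, its cycles and their weight\<close>

text \<open>
  A lift of \<open>gamma\<close> to the universal cover of the cycle; a natural number \<open>y\<close> covers the vertex
  \<open>Suc (y mod n)\<close>.
\<close>

definition gamma_lift :: "nat \<Rightarrow> nat" where
  "gamma_lift y = y + proj_dim (Suc (y mod n))"

lemma gamma_lift_period: "gamma_lift (y + n) = gamma_lift y + n"
  by (simp add: gamma_lift_def)

lemma tau_Suc_mod: "tau n (Suc (y mod n)) = Suc (Suc y mod n)"
  using order_pos by (simp add: tau_def mod_Suc)

lemma tau_funpow_Suc_mod: "(tau n ^^ m) (Suc (y mod n)) = Suc ((y + m) mod n)"
  by (induction m) (simp_all add: tau_Suc_mod)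

lemma mono_gamma_lift: "mono gamma_lift"
proof (rule incseq_SucI)
  fix y
  have "Suc (y mod n) \<in> {1..n}" using order_pos by (simp add: Suc_le_eq)
  from proj_dim_le_tau[OF this] show "gamma_lift y \<le> gamma_lift (Suc y)"
    by (simp add: gamma_lift_def tau_Suc_mod)
qed

lemma gamma_closed: "a \<in> {1..n} \<Longrightarrow> gamma a \<in> {1..n}"
  unfolding gamma_def by (rule funpow_closed) (use tau_closed in auto)

lemma gamma_funpow: "(gamma ^^ k) (Suc (y mod n)) = Suc ((gamma_lift ^^ k) y mod n)"
proof -
  have "gamma (Suc (y mod n)) = Suc (gamma_lift y mod n)" for y
    by (simp add: gamma_def gamma_lift_def tau_funpow_Suc_mod)
  then show ?thesis by (induction k) simp_all
qed

lemma gamma_lift_funpow_eq_sum: "(gamma_lift ^^ k) y = y + (\<Sum>j<k. proj_dim (Suc ((gamma_lift ^^ j) y mod n)))"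
  by (induction k) (simp_all add: gamma_lift_def)

text \<open>A cycle of the resolution quiver with a base point. The base point \<open>Suc r\<close>
  is shifted down so that \<open>r\<close> is a point of the cover in the first period.\<close>

definition least_period :: "nat \<Rightarrow> nat \<Rightarrow> bool" where
  "least_period r l \<longleftrightarrow> r < n \<and> l > 0 \<and> (gamma ^^ l) (Suc r) = Suc r
    \<and> (\<forall>j. 0 < j \<and> j < l \<longrightarrow> (gamma ^^ j) (Suc r) \<noteq> Suc r)"

lemma gamma_lift_funpow_period:
  assumes "least_period r l"
  shows "(gamma_lift ^^ l) r = r + n * ((gamma_lift ^^ l) r div n)"
proof -
  have "(gamma_lift ^^ l) r mod n = r" using assms gamma_funpow[of l r] by (simp add: least_period_def)
  then show ?thesis by (metis mod_mult_div_eq)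
qed

text \<open>\<open>common_rotation\<close> turns the return time of one cycle into a return time of
  the other, with the same winding number. Minimality bounds each length by the other, and then the
  windings agree as well.\<close>

lemma least_period_unique:
  assumes "least_period r l" "least_period r' l'"
  shows "l' = l" and "(gamma_lift ^^ l') r' div n = (gamma_lift ^^ l) r div n"
proof -
  have rotation: "(gamma_lift ^^ l) r' = r' + n * ((gamma_lift ^^ l) r div n)"
    if "least_period r l" "least_period r' l'" for r l r' l'
    by (rule common_rotation[OF gamma_lift_period mono_gamma_lift _ gamma_lift_funpow_period[OF that(1)]
          _ gamma_lift_funpow_period[OF that(2)]])
      (use that in \<open>auto simp: least_period_def\<close>)
  have le: "l' \<le> l" if "least_period r l" "least_period r' l'" for r l r' l'
  proof -
    have "(gamma ^^ l) (Suc r') = Suc r'"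
      using gamma_funpow[of l r'] rotation[OF that] that by (simp add: least_period_def)
    then show ?thesis using that unfolding least_period_def by (meson not_le)
  qed
  show "l' = l" using le assms by (simp add: order.eq_iff)
  then show "(gamma_lift ^^ l') r' div n = (gamma_lift ^^ l) r div n"
    using rotation[OF assms] assms by (simp add: least_period_def)
qed

lemma resolution_quiver_eq: "resolution_quiver = functional_quiver {1..n} gamma"
  by (simp add: resolution_quiver_def functional_quiver_def)

text \<open>Each step of the lift advances by the dimension of a projective, so the dimensions along
  a cycle add up to \<open>n\<close> times the number of turns: the weight is the winding number.
  Injectivity is needed because the weight sums over a set of vertices.\<close>

lemma cycle_weight_orbit:
  assumes "least_period r l"
  shows "cycle_weight (orbit_list gamma (Suc r) l) = of_nat ((gamma_lift ^^ l) r div n)"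
proof -
  have inj: "inj_on (\<lambda>j. (gamma ^^ j) (Suc r)) {..<l}"
    by (rule inj_on_funpow_least_period) (use assms in \<open>auto simp: least_period_def\<close>)
  have orbit: "(gamma ^^ j) (Suc r) = Suc ((gamma_lift ^^ j) r mod n)" for j
    using gamma_funpow[of j r] assms by (simp add: least_period_def)
  have "(\<Sum>a\<in>tail resolution_quiver ` set (orbit_list gamma (Suc r) l). of_nat (proj_dim a) :: rat)
      = of_nat (\<Sum>j<l. proj_dim (Suc ((gamma_lift ^^ j) r mod n)))"
    using inj by (simp add: resolution_quiver_eq set_orbit_list sum.reindex orbit)
  also have "(\<Sum>j<l. proj_dim (Suc ((gamma_lift ^^ j) r mod n))) = n * ((gamma_lift ^^ l) r div n)"
    using gamma_lift_funpow_eq_sum[of l r] gamma_lift_funpow_period[OF assms] by simp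
  finally show ?thesis using order_pos unfolding cycle_weight_def by simp
qed

lemma cycle_iff_least_period:
  "pre_digraph.cycle resolution_quiver es \<longleftrightarrow> (\<exists>r l. least_period r l \<and> es = orbit_list gamma (Suc r) l)"
proof -
  have iff: "pre_digraph.cycle resolution_quiver es \<longleftrightarrow> (\<exists>u m. u \<in> {1..n} \<and> m > 0
      \<and> es = orbit_list gamma u m \<and> (gamma ^^ m) u = u \<and> inj_on (\<lambda>j. (gamma ^^ j) u) {..<m})"
    unfolding resolution_quiver_eq by (rule cycle_functional_quiver) (rule gamma_closed)
  show ?thesis
  proof
    assume "pre_digraph.cycle resolution_quiver es"
    then obtain u m where u: "u \<in> {1..n}" "m > 0" "es = orbit_list gamma u m" "(gamma ^^ m) u = u"
        "inj_on (\<lambda>j. (gamma ^^ j) u) {..<m}"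
      unfolding iff by (elim exE conjE) (rule that)
    have "(gamma ^^ j) u \<noteq> u" if "0 < j" "j < m" for j
      using inj_onD[OF u(5), of j 0] that by auto
    with u show "\<exists>r l. least_period r l \<and> es = orbit_list gamma (Suc r) l"
      by (intro exI[of _ "u - 1"] exI[of _ m]) (auto simp: least_period_def)
  next
    assume "\<exists>r l. least_period r l \<and> es = orbit_list gamma (Suc r) l"
    then obtain r l where r: "least_period r l" "es = orbit_list gamma (Suc r) l" by blast
    moreover have "inj_on (\<lambda>j. (gamma ^^ j) (Suc r)) {..<l}"
      by (rule inj_on_funpow_least_period) (use r in \<open>auto simp: least_period_def\<close>)
    ultimately show "pre_digraph.cycle resolution_quiver es"
      unfolding iff by (intro exI[of _ "Suc r"] exI[of _ l]) (auto simp: least_period_def)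
  qed
qed

text \<open>The definite description needs that all cycles agree, which is
  \<open>least_period_unique\<close>, and that a cycle exists to pin the value down, which the
  assumption supplies.\<close>

lemma weight_eq:
  assumes "least_period r l"
  shows "weight = (gamma_lift ^^ l) r div n"
  unfolding weight_def
proof (rule the_equality)
  show "\<forall>es. pre_digraph.cycle resolution_quiver es \<longrightarrow> cycle_weight es = of_nat ((gamma_lift ^^ l) r div n)"
    using cycle_weight_orbit least_period_unique(2)[OF assms] by (auto simp: cycle_iff_least_period)
next
  fix w assume "\<forall>es. pre_digraph.cycle resolution_quiver es \<longrightarrow> cycle_weight es = of_nat w"
  then have "cycle_weight (orbit_list gamma (Suc r) l) = of_nat w"
    using assms by (auto simp: cycle_iff_least_period)
  then show "w = (gamma_lift ^^ l) r div n" using cycle_weight_orbit[OF assms] by simp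
qed

section \<open>The determinant for the winding grading and for an arbitrary grading\<close>

text \<open>
  The Cartan matrix for the grading with \<open>x\<^sub>n\<close> in degree \<open>1\<close> and all other arrows in degree \<open>0\<close>.
\<close>

definition unrolled_cartan :: "int poly mat" where
  "unrolled_cartan = Matrix.mat n n (\<lambda>(i, j). \<Sum>m<proj_dim (Suc j). cover_vec n i (j + m))"

text \<open>That there is a component at all is recorded because the case of total degree 0 has the
  exponent \<open>c - 1\<close>, a truncated subtraction.\<close>

lemma det_unrolled_cartan:
  shows "num_components > 0"
    and "(1 - monom 1 1) * det unrolled_cartan = (1 - monom 1 weight) ^ num_components"
proof -
  obtain S where S: "S \<subseteq> {1..n}" "card S = num_components"
    and periodic: "\<And>r. r \<in> S \<Longrightarrow> \<exists>l>0. (gamma ^^ l) r = r"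
    and once: "\<And>r j. \<lbrakk>r \<in> S; (gamma ^^ j) r \<in> S\<rbrakk> \<Longrightarrow> (gamma ^^ j) r = r"
    and reach: "\<And>i. i \<in> {1..n} \<Longrightarrow> \<exists>k. (gamma ^^ k) i \<in> S"
    using component_representatives[of "{1..n}" gamma, OF _ gamma_closed]
    unfolding num_components_def resolution_quiver_eq by blast
  have "S \<noteq> {}" using reach[of 1] order_pos by auto
  moreover have "finite S" using S finite_subset by blast
  ultimately show "num_components > 0" using S(2) by (metis card_gt_0_iff)
  define T where "T = {r. Suc r \<in> S}"
  have S_T: "S = Suc ` T" using S(1) by (force simp: T_def image_iff Suc_le_eq dest: gr0_implies_Suc)
  then have card_T: "card T = num_components" using S(2) by (simp add: card_image)
  have T_less: "T \<subseteq> {..<n}" using S(1) by (auto simp: S_T)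
  define l where "l r = (LEAST l. 0 < l \<and> (gamma ^^ l) (Suc r) = Suc r)" for r
  have l: "least_period r (l r)" if "r \<in> T" for r
  proof -
    have "\<exists>l. 0 < l \<and> (gamma ^^ l) (Suc r) = Suc r" using periodic[of "Suc r"] that by (auto simp: S_T)
    then have "0 < l r \<and> (gamma ^^ l r) (Suc r) = Suc r" unfolding l_def by (rule LeastI_ex)
    moreover have "(gamma ^^ j) (Suc r) \<noteq> Suc r" if "0 < j" "j < l r" for j
      using that not_less_Least[of j] unfolding l_def by blast
    ultimately show ?thesis using T_less that by (auto simp: least_period_def)
  qed
  have in_T: "(gamma_lift ^^ k) r mod n \<in> T \<longleftrightarrow> (gamma ^^ k) (Suc r) \<in> S" if "r < n" for k r
    using gamma_funpow[of k r] that by (simp add: T_def)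
  have "(1 - monom 1 1) * det unrolled_cartan = (\<Prod>r\<in>T. 1 - monom 1 ((gamma_lift ^^ l r) r div n))"
    unfolding unrolled_cartan_def
  proof (rule det_interval_mat[where f = gamma_lift and l = l])
    show "0 < l r \<and> (gamma_lift ^^ l r) r = r + n * ((gamma_lift ^^ l r) r div n)" if "r \<in> T" for r
      using gamma_lift_funpow_period[OF l[OF that]] l[OF that] by (auto simp: least_period_def)
    show "(gamma_lift ^^ j) r mod n \<notin> T" if "r \<in> T" "0 < j" "j < l r" for r j
    proof
      assume "(gamma_lift ^^ j) r mod n \<in> T"
      \<comment> \<open>Representatives meet each orbit at most once, so a return to
        \<open>T\<close> is a return to \<open>r\<close>, too early for its least period.\<close>
      then have "(gamma ^^ j) (Suc r) = Suc r"
        using in_T[of r j] once[of "Suc r" j] T_less that by (auto simp: S_T)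
      then show False using l[OF that(1)] that by (auto simp: least_period_def)
    qed
    show "\<exists>k. (gamma_lift ^^ k) i mod n \<in> T" if "i < n" for i
      using reach[of "Suc i"] in_T[OF that] that by auto
  qed (use order_pos T_less in \<open>auto simp: gamma_lift_def\<close>)
  also have "\<dots> = (\<Prod>r\<in>T. 1 - monom 1 weight)"
    by (intro prod.cong refl) (simp add: weight_eq[OF l])
  finally show "(1 - monom 1 1) * det unrolled_cartan = (1 - monom 1 weight) ^ num_components"
    by (simp add: card_T)
qed

text \<open>
  The degree of the path of length \<open>y\<close> starting at the vertex \<open>1\<close>; as a potential on the universal
  cover it conjugates the given grading to the one that counts windings.
\<close>

definition degree_upto :: "(nat \<Rightarrow> int) \<Rightarrow> nat \<Rightarrow> int" where
  "degree_upto \<d> y = (\<Sum>a=1..y mod n. \<d> a) + (\<Sum>a=1..n. \<d> a) * int (y div n)"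

lemma degree_upto_Suc: "degree_upto \<d> (Suc y) = degree_upto \<d> y + \<d> (Suc (y mod n))"
proof (cases "Suc (y mod n) = n")
  case True
  then have "(\<Sum>a=1..n. \<d> a) = (\<Sum>a=1..y mod n. \<d> a) + \<d> (Suc (y mod n))"
    by (metis sum.nat_ivl_Suc' Suc_eq_plus1 le_add2 add.commute)
  with True show ?thesis by (simp add: degree_upto_def mod_Suc div_Suc algebra_simps)
next
  case False
  then show ?thesis by (simp add: degree_upto_def mod_Suc div_Suc)
qed

lemma degree_walk:
  assumes "j < n"
  shows "(\<Sum>k<m. \<d> ((tau n ^^ k) (Suc j))) = degree_upto \<d> (j + m) - degree_upto \<d> j"
  using tau_funpow_Suc_mod[of _ j] assms by (induction m) (simp_all add: degree_upto_Suc)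

lemma graded_cartan_index:
  assumes "i < n" "j < n"
  shows "graded_cartan \<d> $$ (i, j) = (\<Sum>m<proj_dim (Suc j).
    if (j + m) mod n = i then tpow (degree_upto \<d> (j + m) - degree_upto \<d> j) else 0)"
proof -
  let ?M = "{m \<in> {..<proj_dim (Suc j)}. (j + m) mod n = i}"
  let ?e = "\<lambda>m. degree_upto \<d> (j + m) - degree_upto \<d> j"
  have dims: "cartan_dim \<d> (i + 1) (j + 1) l = card {m \<in> ?M. ?e m = l}" for l
  proof -
    have "Suc i \<in> {1..n}" "Suc j \<in> {1..n}" using assms by auto
    then have "cartan_dim \<d> (i + 1) (j + 1) l
        = card {m \<in> {..<proj_dim (Suc j)}. (tau n ^^ m) (Suc j) = Suc i \<and> ?e m = l}"
      by (simp only: cartan_dim_eq Suc_eq_plus1[symmetric] degree_walk[OF assms(2)])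
    then show ?thesis using tau_funpow_Suc_mod[of _ j] assms by (simp add: conj_assoc)
  qed
  have "graded_cartan \<d> $$ (i, j) = (\<Sum>l | cartan_dim \<d> (i + 1) (j + 1) l \<noteq> 0.
      Poly_Mapping.single l (int (cartan_dim \<d> (i + 1) (j + 1) l)))"
    using assms by (simp add: graded_cartan_def)
  also have "\<dots> = (\<Sum>m\<in>?M. tpow (?e m))"
    unfolding dims by (rule sum_single_card_fibre) simp
  also have "\<dots> = (\<Sum>m<proj_dim (Suc j). if (j + m) mod n = i then tpow (?e m) else 0)"
    by (rule sum.inter_filter) simp
  finally show ?thesis .
qed

text \<open>The potential at a point of the cover is its value at the residue plus d times the
  number of turns. The residue parts depend on row and column alone and are conjugated away; the
  turns are the exponents of s.\<close>

lemma det_graded_cartan: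
  "det (graded_cartan \<d>) = poly (map_poly of_int (det unrolled_cartan)) (tpow (\<Sum>a=1..n. \<d> a))"
proof -
  define d where "d = (\<Sum>a=1..n. \<d> a)"
  let ?h = "\<lambda>P :: int poly. poly (map_poly of_int P) (tpow d)"
  interpret h: comm_ring_hom ?h by (rule comm_ring_hom_poly_map_of_int)
  have degree: "degree_upto \<d> y = degree_upto \<d> (y mod n) + d * int (y div n)" for y
    by (simp add: degree_upto_def d_def)
  have cover: "tpow (degree_upto \<d> i) * tpow (- degree_upto \<d> j) * ?h (cover_vec n i y)
      = (if y mod n = i then tpow (degree_upto \<d> y - degree_upto \<d> j) else 0)" for i j y
    using degree[of y] by (auto simp: cover_vec_def map_poly_monom poly_monom tpow_power mult_single
        algebra_simps)
  have "det (graded_cartan \<d>) = det (map_mat ?h unrolled_cartan)"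
  proof (rule det_diagonal_conjugate)
    show "graded_cartan \<d> \<in> carrier_mat n n" "map_mat ?h unrolled_cartan \<in> carrier_mat n n"
      by (simp_all add: graded_cartan_def unrolled_cartan_def)
    show "tpow (degree_upto \<d> i) * tpow (- degree_upto \<d> i) = 1" for i by (simp add: mult_single)
    fix i j assume ij: "i < n" "j < n"
    then show "graded_cartan \<d> $$ (i, j)
        = tpow (degree_upto \<d> i) * tpow (- degree_upto \<d> j) * map_mat ?h unrolled_cartan $$ (i, j)"
      by (simp add: graded_cartan_index unrolled_cartan_def h.hom_sum sum_distrib_left cover)
  qed
  then show ?thesis unfolding h.hom_det by (simp only: d_def)
qed

end

theorem theorem4p4:
  fixes scale :: "'k::field \<Rightarrow> 'a::ring_1 \<Rightarrow> 'a"
    and n :: nat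
    and rels :: "(nat \<times> nat list) set"
    and \<phi> :: "((nat \<times> nat list) \<Rightarrow>\<^sub>0 'k) \<Rightarrow> 'a"
    and \<d> :: "nat \<Rightarrow> int"
    and c w :: nat
    and d :: int
  assumes "nakayama_algebra scale n rels \<phi>"
    and "c = nakayama_algebra.num_components scale n \<phi>"
    and "w = nakayama_algebra.weight scale n \<phi>"
    and "d = (\<Sum>a=1..n. \<d> a)"
  shows "(d \<noteq> 0 \<longrightarrow>
            to_fract (det (nakayama_algebra.graded_cartan scale n \<phi> \<d>))
              = to_fract ((1 - tpow (d * int w)) ^ c) / to_fract (1 - tpow d))
       \<and> (d = 0 \<longrightarrow>
            det (nakayama_algebra.graded_cartan scale n \<phi> \<d>)
              = of_int (poly ((\<Sum>i<w. monom 1 i) * (1 - monom 1 w) ^ (c - 1)) 1))"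
proof -
  interpret nakayama_algebra scale n rels \<phi> by (rule assms(1))
  let ?h = "\<lambda>P :: int poly. poly (map_poly of_int P) (tpow d)"
  interpret h: comm_ring_hom ?h by (rule comm_ring_hom_poly_map_of_int)
  have det: "det (graded_cartan \<d>) = ?h (det unrolled_cartan)"
    by (simp add: det_graded_cartan assms(4))
  have monom: "?h (monom 1 k) = tpow (d * int k)" for k
    by (simp add: map_poly_monom poly_monom tpow_power)
  have unrolled: "(1 - monom 1 1) * det unrolled_cartan = (1 - monom 1 w) ^ c"
    using det_unrolled_cartan(2) assms(2,3) by simp
  show ?thesis
  proof (intro conjI impI)
    assume "d \<noteq> 0"
    have "(1 - tpow d) * det (graded_cartan \<d>) = ?h ((1 - monom 1 1) * det unrolled_cartan)"
      unfolding h.hom_mult h.hom_minus h.hom_one monom det by simp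
    also have "\<dots> = (1 - tpow (d * int w)) ^ c"
      unfolding unrolled h.hom_power h.hom_minus h.hom_one monom ..
    finally have eq: "det (graded_cartan \<d>) * (1 - tpow d) = (1 - tpow (d * int w)) ^ c"
      by (simp add: mult.commute)
    \<comment> \<open>For nonzero \<open>d\<close> the monomial \<open>tpow d\<close> does not touch
      the constant coefficient, so the denominator is nonzero.\<close>
    have "Poly_Mapping.lookup (1 - tpow d :: int \<Rightarrow>\<^sub>0 int) 0 = 1"
      using \<open>d \<noteq> 0\<close> by (simp add: lookup_minus lookup_one lookup_single when_def)
    then have "1 - tpow d \<noteq> 0" by (metis lookup_zero zero_neq_one)
    then have nonzero: "to_fract (1 - tpow d) \<noteq> 0" by (simp only: to_fract_eq_0_iff not_False_eq_True)
    show "to_fract (det (graded_cartan \<d>))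
        = to_fract ((1 - tpow (d * int w)) ^ c) / to_fract (1 - tpow d)"
      by (simp only: eq[symmetric] to_fract_mult nonzero_mult_div_cancel_right[OF nonzero])
  next
    assume "d = 0"
    have "c > 0" using det_unrolled_cartan(1) assms(2) by simp
    then obtain c' where c': "c = Suc c'" by (cases c) auto
    \<comment> \<open>The geometric sum splits 1 - s off one of the \<open>c\<close> factors. It has
      to be cancelled here: under the specialisation to \<open>s = 1\<close> it becomes
      zero.\<close>
    have "(1 - monom 1 w :: int poly) = (1 - monom 1 1) * (\<Sum>i<w. monom 1 i)"
      using one_diff_power_eq[of "monom 1 1 :: int poly" w] by (simp add: monom_power)
    then have "(1 - monom 1 w) ^ c
        = (1 - monom 1 1) * (\<Sum>i<w. monom 1 i) * (1 - monom 1 w :: int poly) ^ (c - 1)"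
      unfolding c' power_Suc diff_Suc_1 by (rule arg_cong[where f = "\<lambda>P. P * (1 - monom 1 w) ^ c'"])
    then have "(1 - monom 1 1) * det unrolled_cartan
        = (1 - monom 1 1) * ((\<Sum>i<w. monom 1 i) * (1 - monom 1 w) ^ (c - 1))"
      by (simp only: unrolled mult.assoc)
    moreover have "(1 - monom 1 1 :: int poly) \<noteq> 0"
    proof -
      have "coeff (1 - monom 1 1 :: int poly) 0 = 1" by simp
      then show ?thesis by (metis coeff_0 zero_neq_one)
    qed
    ultimately have unrolled_eq: "det unrolled_cartan = (\<Sum>i<w. monom 1 i) * (1 - monom 1 w) ^ (c - 1)"
      using mult_left_cancel by blast
    \<comment> \<open>With s sent to 1 the determinant is the integer value at 1 of the cancelled
      polynomial.\<close>
    have "tpow d = 1" using \<open>d = 0\<close> by simp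
    then show "det (graded_cartan \<d>)
        = of_int (poly ((\<Sum>i<w. monom 1 i) * (1 - monom 1 w) ^ (c - 1)) 1)"
      using poly_map_of_int[of "det unrolled_cartan" 1] unfolding det unrolled_eq[symmetric] by simp
  qed
qed

end
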